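(* Let $n\in\{3,4\}$ and let $F=F(x,y)$ be a given function. The $n$th order equation $\Omega_F^n[y]=0$ is linearizable by a point transformation if and only if $F_y=0$ (i.e. $F=F(x)$ depends on $x$ only), in which case the equation is already linear.
   Context: For a scalar function $F=F(x,y)$, the operator $\Omega_F=\frac{d}{dx}+F(x,y)$ acts, for $y=y(x)$, by $\Omega_F[u]=\frac{du}{dx}+F(x,y(x))\,u$ (the coefficient $F$ always being evaluated at the original unknown $y$). In particular $\Omega_F[y]=y_x+F(x,y)y$, and $\Omega_F^n[y]$ denotes the $n$-fold iterate applied to $y$, so that $\Omega_F^n[y]=\Omega_F\big[\Omega_F^{n-1}[y]\big]$. All functions are assumed sufficiently smooth and considered locally. A point transformation is a locally invertible change of variables $z=\rho(x,y)$, $w=\psi(x,y)$ (nonzero Jacobian) of the independent and dependent variables. An ODE is linearizable by a point transformation if some point transformation maps it to a linear ODE. *)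

theory Defs
  imports "HOL-Analysis.Analysis" "HOL-Library.Extended_Nat"
begin

text \<open>Functions of class \<open>C\<^sup>k\<close> on an open set \<open>S\<close>; \<open>C_class \<infinity>\<close> is \<open>C\<^sup>\<infinity>\<close>.\<close>

primrec Ck_on :: "nat \<Rightarrow> ('a::euclidean_space \<Rightarrow> real) \<Rightarrow> 'a set \<Rightarrow> bool" where
  "Ck_on 0 f S = continuous_on S f"
| "Ck_on (Suc k) f S =
     (f differentiable_on S \<and> (\<forall>i\<in>Basis. Ck_on k (\<lambda>x. frechet_derivative f (at x) i) S))"

definition C_class :: "enat \<Rightarrow> ('a::euclidean_space \<Rightarrow> real) \<Rightarrow> 'a set \<Rightarrow> bool" where
  "C_class r f S \<longleftrightarrow> (\<forall>k. enat k \<le> r \<longrightarrow> Ck_on k f S)"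

definition pd_x :: "(real \<times> real \<Rightarrow> real) \<Rightarrow> real \<times> real \<Rightarrow> real" where
  "pd_x f p = deriv (\<lambda>s. f (s, snd p)) (fst p)"

definition pd_y :: "(real \<times> real \<Rightarrow> real) \<Rightarrow> real \<times> real \<Rightarrow> real" where
  "pd_y f p = deriv (\<lambda>t. f (fst p, t)) (snd p)"

definition Omega :: "(real \<times> real \<Rightarrow> real) \<Rightarrow> (real \<Rightarrow> real) \<Rightarrow> (real \<Rightarrow> real) \<Rightarrow> real \<Rightarrow> real" where
  "Omega F y u = (\<lambda>x. deriv u x + F (x, y x) * u x)"

definition Omega_iter :: "(real \<times> real \<Rightarrow> real) \<Rightarrow> nat \<Rightarrow> (real \<Rightarrow> real) \<Rightarrow> real \<Rightarrow> real" where
  "Omega_iter F n y = (Omega F y ^^ n) y"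

text \<open>
  An ODE \<open>E[y] = 0\<close> is represented by the operator \<open>E\<close>; \<open>E y x\<close> is the value of its
  left-hand side along \<open>y\<close> at the point \<open>x\<close>. The linear ODE of order \<open>n\<close> with coefficients
  \<open>a\<close> and right-hand side \<open>b\<close> is \<open>a\<^sub>n w\<^sup>(\<^sup>n\<^sup>) + \<dots> + a\<^sub>1 w' + a\<^sub>0 w - b = 0\<close>.
\<close>

definition linear_ode :: "nat \<Rightarrow> (nat \<Rightarrow> real \<Rightarrow> real) \<Rightarrow> (real \<Rightarrow> real) \<Rightarrow>
    (real \<Rightarrow> real) \<Rightarrow> real \<Rightarrow> real" where
  "linear_ode n a b w z = (\<Sum>k\<le>n. a k z * (deriv ^^ k) w z) - b z"

definition linear_coeffs_on :: "nat \<Rightarrow> (nat \<Rightarrow> real \<Rightarrow> real) \<Rightarrow> (real \<Rightarrow> real) \<Rightarrow> real set \<Rightarrow> bool" where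
  "linear_coeffs_on n a b Z \<longleftrightarrow>
     (\<forall>k\<le>n. continuous_on Z (a k)) \<and> continuous_on Z b \<and> (\<forall>z\<in>Z. a n z \<noteq> 0)"

definition point_transformation ::
    "enat \<Rightarrow> (real \<times> real) set \<Rightarrow> (real \<times> real \<Rightarrow> real) \<Rightarrow> (real \<times> real \<Rightarrow> real) \<Rightarrow> bool" where
  "point_transformation r V \<rho> \<psi> \<longleftrightarrow>
     C_class r \<rho> V \<and> C_class r \<psi> V \<and>
     (\<forall>p\<in>V. pd_x \<rho> p * pd_y \<psi> p - pd_y \<rho> p * pd_x \<psi> p \<noteq> 0)"

definition curve_in :: "nat \<Rightarrow> (real \<times> real) set \<Rightarrow> real set \<Rightarrow> (real \<Rightarrow> real) \<Rightarrow> bool" where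
  "curve_in n V I y \<longleftrightarrow>
     (\<exists>s t. I = {s<..<t}) \<and> C_class (enat n) y I \<and> (\<forall>x\<in>I. (x, y x) \<in> V)"

text \<open>
  The function \<open>w\<close> is the image of \<open>y\<close> (on the interval \<open>I\<close>) under \<open>z = \<rho>(x,y)\<close>,
  \<open>w = \<psi>(x,y)\<close>. The condition on the derivative says that \<open>x \<mapsto> \<rho>(x, y(x))\<close> is an admissible
  new independent variable; then the image of \<open>I\<close> is an open interval, and on it \<open>w\<close> exists,
  is unique, and is as smooth as \<open>\<rho>\<close>, \<open>\<psi>\<close> and \<open>y\<close> allow.
\<close>

definition transforms_to :: "(real \<times> real \<Rightarrow> real) \<Rightarrow> (real \<times> real \<Rightarrow> real) \<Rightarrow> real set \<Rightarrow>
    (real \<Rightarrow> real) \<Rightarrow> (real \<Rightarrow> real) \<Rightarrow> bool" where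
  "transforms_to \<rho> \<psi> I y w \<longleftrightarrow>
     (\<forall>x\<in>I. deriv (\<lambda>x. \<rho> (x, y x)) x \<noteq> 0 \<and> w (\<rho> (x, y x)) = \<psi> (x, y x))"

text \<open>
  The transformation maps the equation \<open>E\<close> to the equation \<open>L\<close> over \<open>V\<close>: for every curve \<open>y\<close>
  with image \<open>w\<close>, the equation \<open>E[y] = 0\<close> holds at \<open>x\<close> iff \<open>L[w] = 0\<close> holds at the
  corresponding point \<open>z\<close>. In particular solutions correspond to solutions.
\<close>

definition maps_ode :: "nat \<Rightarrow> (real \<times> real) set \<Rightarrow> (real \<times> real \<Rightarrow> real) \<Rightarrow> (real \<times> real \<Rightarrow> real) \<Rightarrow>
    ((real \<Rightarrow> real) \<Rightarrow> real \<Rightarrow> real) \<Rightarrow> ((real \<Rightarrow> real) \<Rightarrow> real \<Rightarrow> real) \<Rightarrow> bool" where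
  "maps_ode n V \<rho> \<psi> E L \<longleftrightarrow>
     (\<forall>I y w. curve_in n V I y \<and> transforms_to \<rho> \<psi> I y w \<longrightarrow>
        (\<forall>x\<in>I. E y x = 0 \<longleftrightarrow> L w (\<rho> (x, y x)) = 0))"

text \<open>
  Local notions at a point \<open>p\<close> of the open set \<open>U\<close> over which the \<open>n\<close>th order equation \<open>E\<close>
  is defined.
\<close>

definition linearizable_at :: "enat \<Rightarrow> nat \<Rightarrow> ((real \<Rightarrow> real) \<Rightarrow> real \<Rightarrow> real) \<Rightarrow>
    (real \<times> real) set \<Rightarrow> real \<times> real \<Rightarrow> bool" where
  "linearizable_at r n E U p \<longleftrightarrow>
     (\<exists>V \<rho> \<psi> a b. open V \<and> p \<in> V \<and> V \<subseteq> U \<and> point_transformation r V \<rho> \<psi> \<and>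
        linear_coeffs_on n a b (\<rho> ` V) \<and> maps_ode n V \<rho> \<psi> E (linear_ode n a b))"

definition linear_at :: "nat \<Rightarrow> ((real \<Rightarrow> real) \<Rightarrow> real \<Rightarrow> real) \<Rightarrow>
    (real \<times> real) set \<Rightarrow> real \<times> real \<Rightarrow> bool" where
  "linear_at n E U p \<longleftrightarrow>
     (\<exists>V a b. open V \<and> p \<in> V \<and> V \<subseteq> U \<and> linear_coeffs_on n a b (fst ` V) \<and>
        (\<forall>I y. curve_in n V I y \<longrightarrow> (\<forall>x\<in>I. E y x = linear_ode n a b y x)))"

end

theory Submission
  imports Defs
begin

text \<open>
  Why linearizability forces \<open>F\<^sub>y = 0\<close>. Let \<open>z = \<rho>(x, y)\<close>, \<open>w = \<psi>(x, y)\<close> map \<open>\<Omega>\<^sup>n[y] = 0\<close> to a linear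
  equation \<open>L[w] = 0\<close> with leading coefficient \<open>a\<^sub>n\<close>. For a curve \<open>y\<close> let \<open>R\<close> and \<open>S\<close> be the total
  derivatives of \<open>\<rho>(x, y(x))\<close> and \<open>\<psi>(x, y(x))\<close>, and let \<open>J\<close> be the Jacobian. For fixed lower
  derivatives, \<open>\<Omega>\<^sup>n[y]\<close> and \<open>L[w]\<close> are both affine in \<open>y\<^sup>(\<^sup>n\<^sup>)\<close>, with slopes \<open>1\<close> and \<open>a\<^sub>n J / R\<^sup>n\<^sup>+\<^sup>1\<close>,
  and they vanish together. So they are proportional along every curve, solution or not:

    \<open>L[w] = a\<^sub>n J / R\<^sup>n\<^sup>+\<^sup>1 \<cdot> \<Omega>\<^sup>n[y]\<close>    (\<open>key_identity\<close>).

  No differential equation is ever solved; curves are polynomials, and information is extracted by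
  changing a single derivative of a curve at a single point. The identity is exploited three times.

  \<^item> \<open>\<rho>\<^sub>y = 0\<close> (\<open>rho_y_zero\<close>). If \<open>\<rho>\<^sub>y \<noteq> 0\<close> somewhere, there is a curve through that point along which
    \<open>R\<close> has a simple zero. Multiply by \<open>R\<^sup>2\<^sup>n\<^sup>-\<^sup>1\<close> and pass to the limit: since \<open>n > 2\<close> the right-hand
    side tends to zero, while the left-hand side tends to a nonzero multiple of \<open>a\<^sub>n S R'\<^sup>n\<^sup>-\<^sup>1\<close>.
  \<^item> \<open>\<psi>\<^sub>y\<^sub>y = 0\<close> (\<open>psi_yy_zero\<close>). Now \<open>L[w]\<close> is a linear differential expression in \<open>\<psi>(x, y(x))\<close> with
    coefficients depending on \<open>x\<close> only (\<open>reduced_identity\<close>). In the coefficient of \<open>y\<^sup>(\<^sup>n\<^sup>-\<^sup>1\<^sup>)\<close> it has the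
    term \<open>n \<psi>\<^sub>y\<^sub>y y'\<close>, but the corresponding coefficient \<open>n F + y F\<^sub>y\<close> of \<open>\<Omega>\<^sup>n[y]\<close> is free of \<open>y'\<close>.
  \<^item> \<open>F\<^sub>y = 0\<close> (\<open>F_y_zero\<close>). Now \<open>\<psi>(x, y(x))\<close>, and hence \<open>\<Omega>\<^sup>n[y]\<close>, is affine in \<open>y\<close> (\<open>Om_affine\<close>). So
    \<open>n F + y F\<^sub>y\<close> does not depend on \<open>y\<close>; and along lines of slope \<open>s\<close> the coefficient of \<open>s\<^sup>n\<^sup>-\<^sup>1\<close>, which
    is the \<open>y\<close>-derivative of order \<open>n - 2\<close> of \<open>2 F + y F\<^sub>y\<close>, vanishes. Together these leave only
    \<open>F\<^sub>y = 0\<close> (\<open>euler_rigidity\<close>).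

  This works for every \<open>n \<ge> 3\<close>. Conversely, if \<open>F\<^sub>y = 0\<close> near a point, then on a box \<open>F\<close> is a function of
  \<open>x\<close>, expanding \<open>(d/dx + F(x))\<^sup>n\<close> exhibits the equation as linear, and the identity transformation
  linearizes it.
\<close>

section \<open>Functions of class \<open>C\<^sup>k\<close>\<close>

lemma Ck_on_imp_continuous_on: "Ck_on k f S \<Longrightarrow> continuous_on S f"
  by (cases k) (auto intro: differentiable_imp_continuous_on)

lemma Ck_on_mono: "Ck_on k f S \<Longrightarrow> j \<le> k \<Longrightarrow> Ck_on j f S"
proof (induction k arbitrary: f j)
  case (Suc k)
  then show ?case
    by (cases j) (auto intro: differentiable_imp_continuous_on)
qed auto

lemma Ck_on_subset: "Ck_on k f S \<Longrightarrow> T \<subseteq> S \<Longrightarrow> Ck_on k f T"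
  by (induction k arbitrary: f) (auto intro: continuous_on_subset differentiable_on_subset)

lemma frechet_derivative_cong_open:
  assumes "open S" "x \<in> S" "\<And>x. x \<in> S \<Longrightarrow> f x = g x"
  shows "frechet_derivative f (at x) = frechet_derivative g (at x)"
proof -
  have "(f has_derivative D) (at x) \<longleftrightarrow> (g has_derivative D) (at x)" for D
    using assms by (metis has_derivative_transform_within_open)
  then show ?thesis by (simp add: frechet_derivative_def)
qed

lemma Ck_on_cong:
  assumes "open S" "\<And>x. x \<in> S \<Longrightarrow> f x = g x"
  shows "Ck_on k f S \<longleftrightarrow> Ck_on k g S"
  using assms(2)
proof (induction k arbitrary: f g)
  case 0
  then show ?case by (simp cong: continuous_on_cong)
next
  case (Suc k)
  have "f differentiable_on S \<longleftrightarrow> g differentiable_on S"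
    unfolding differentiable_on_def differentiable_def
    using Suc.prems by (metis has_derivative_transform)
  moreover have "Ck_on k (\<lambda>x. frechet_derivative f (at x) i) S \<longleftrightarrow> Ck_on k (\<lambda>x. frechet_derivative g (at x) i) S" for i
    by (rule Suc.IH) (simp add: frechet_derivative_cong_open[OF assms(1) _ Suc.prems])
  ultimately show ?case by simp
qed

lemma Ck_on_const [simp]: "Ck_on k (\<lambda>x. c) S"
  by (induction k arbitrary: c) (auto simp: frechet_derivative_const)

lemma Ck_on_add:
  assumes "open S" "Ck_on k f S" "Ck_on k g S"
  shows "Ck_on k (\<lambda>x. f x + g x) S"
  using assms(2,3)
proof (induction k arbitrary: f g)
  case 0
  then show ?case by (auto intro: continuous_intros)
next
  case (Suc k)
  have d: "f differentiable at x" "g differentiable at x" if "x \<in> S" for x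
    using Suc.prems that assms(1) by (auto simp: differentiable_on_eq_differentiable_at)
  have "frechet_derivative (\<lambda>x. f x + g x) (at x) i = frechet_derivative f (at x) i + frechet_derivative g (at x) i"
    if "x \<in> S" for x i
  proof -
    have "((\<lambda>x. f x + g x) has_derivative
      (\<lambda>h. frechet_derivative f (at x) h + frechet_derivative g (at x) h)) (at x)"
      by (rule has_derivative_add) (use d[OF that] in \<open>auto simp: frechet_derivative_works\<close>)
    then show ?thesis by (simp add: frechet_derivative_at[symmetric])
  qed
  then have "Ck_on k (\<lambda>x. frechet_derivative (\<lambda>x. f x + g x) (at x) i) S" if "i \<in> Basis" for i
    using Suc.IH[of "\<lambda>x. frechet_derivative f (at x) i" "\<lambda>x. frechet_derivative g (at x) i"] Suc.prems that
    by (subst Ck_on_cong[OF assms(1)]) auto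
  then show ?case using Suc.prems by (auto intro: derivative_intros)
qed

lemma Ck_on_mult:
  assumes "open S" "Ck_on k f S" "Ck_on k g S"
  shows "Ck_on k (\<lambda>x. f x * g x) S"
  using assms(2,3)
proof (induction k arbitrary: f g)
  case 0
  then show ?case by (auto intro: continuous_intros)
next
  case (Suc k)
  have d: "f differentiable at x" "g differentiable at x" if "x \<in> S" for x
    using Suc.prems that assms(1) by (auto simp: differentiable_on_eq_differentiable_at)
  have eq: "frechet_derivative (\<lambda>x. f x * g x) (at x) i = f x * frechet_derivative g (at x) i + frechet_derivative f (at x) i * g x"
    if "x \<in> S" for x i
  proof -
    have "((\<lambda>x. f x * g x) has_derivative
      (\<lambda>h. f x * frechet_derivative g (at x) h + frechet_derivative f (at x) h * g x)) (at x)"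
      by (rule has_derivative_mult) (use d[OF that] in \<open>auto simp: frechet_derivative_works\<close>)
    then show ?thesis by (simp add: frechet_derivative_at[symmetric])
  qed
  have m: "Ck_on k f S" "Ck_on k g S"
    using Suc.prems by (auto intro: Ck_on_mono simp del: Ck_on.simps)
  have "Ck_on k (\<lambda>x. frechet_derivative (\<lambda>x. f x * g x) (at x) i) S" if "i \<in> Basis" for i
    using Suc.IH[of "f" "\<lambda>x. frechet_derivative g (at x) i"]
      Suc.IH[of "\<lambda>x. frechet_derivative f (at x) i" g] Suc.prems that m
    by (subst Ck_on_cong[OF assms(1) eq]) (auto intro!: Ck_on_add assms)
  then show ?case using Suc.prems by (auto intro: derivative_intros)
qed

lemma Ck_on_diff:
  assumes "open S" "Ck_on k f S" "Ck_on k g S"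
  shows "Ck_on k (\<lambda>x. f x - g x) S"
  using Ck_on_add[OF assms(1,2) Ck_on_mult[OF assms(1) Ck_on_const[of k "-1"] assms(3)]] by simp

lemma Ck_on_bounded_linear:
  assumes "bounded_linear f" shows "Ck_on k f S"
proof (cases k)
  case 0
  then show ?thesis using assms by (simp add: linear_continuous_on)
next
  case (Suc k)
  have "(f has_derivative f) (at x)" for x
    using assms by (rule bounded_linear_imp_has_derivative)
  then have "frechet_derivative f (at x) = f" for x by (metis frechet_derivative_at)
  then show ?thesis using Suc assms
    by (auto intro: bounded_linear_imp_differentiable_on)
qed

lemma Ck_on_power:
  assumes "open S" "Ck_on k f S" shows "Ck_on k (\<lambda>x. f x ^ m) S"
  by (induction m) (use Ck_on_mult[OF assms(1) assms(2)] in auto)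

text \<open>Together with \<open>Ck_on_Suc_prod\<close> this replaces the Frechet derivatives in \<^const>\<open>Ck_on\<close> by
  ordinary and partial ones.\<close>

lemma Ck_on_Suc_real:
  fixes f :: "real \<Rightarrow> real"
  assumes "open S"
  shows "Ck_on (Suc k) f S \<longleftrightarrow> (\<forall>x\<in>S. (f has_real_derivative deriv f x) (at x)) \<and> Ck_on k (deriv f) S"
proof -
  have 1: "f differentiable at x \<longleftrightarrow> (f has_real_derivative deriv f x) (at x)" for x
    by (metis DERIV_deriv_iff_real_differentiable)
  have 2: "frechet_derivative f (at x) 1 = deriv f x" if "f differentiable at x" for x
    using that 1 by (metis frechet_derivative_at has_field_derivative_def mult.right_neutral)
  show ?thesis
    using assms 1 2 Ck_on_cong[OF assms, of "\<lambda>x. frechet_derivative f (at x) 1" "deriv f" k]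
    by (auto simp: differentiable_on_eq_differentiable_at)
qed

text \<open>The partial derivatives are defined as one-variable derivatives; for differentiable functions
  they are the values of the Frechet derivative on the basis, which is what \<^const>\<open>Ck_on\<close>
  speaks about.\<close>

lemma
  fixes f :: "real \<times> real \<Rightarrow> real"
  assumes "(f has_derivative D) (at p)"
  shows pd_x_eq: "pd_x f p = D (1, 0)" and pd_y_eq: "pd_y f p = D (0, 1)"
    and pd_x_DERIV: "((\<lambda>s. f (s, snd p)) has_real_derivative pd_x f p) (at (fst p))"
    and pd_y_DERIV: "((\<lambda>t. f (fst p, t)) has_real_derivative pd_y f p) (at (snd p))"
proof -
  interpret bounded_linear D using assms by (rule has_derivative_bounded_linear)
  have L: "((\<lambda>s. f (s, snd p)) has_derivative (\<lambda>h. D (h, 0))) (at (fst p))"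
    using has_derivative_compose[OF has_derivative_Pair[OF has_derivative_ident has_derivative_const],
      of f D "fst p" "snd p" UNIV] assms by simp
  have "(\<lambda>h. D (h, 0)) = (*) (D (1, 0))"
  proof
    show "D (h, 0) = D (1, 0) * h" for h using scaleR[of h "(1,0)"] by simp
  qed
  with L have *: "((\<lambda>s. f (s, snd p)) has_real_derivative D (1, 0)) (at (fst p))"
    by (simp add: has_field_derivative_def)
  then show "pd_x f p = D (1, 0)" by (simp add: pd_x_def DERIV_imp_deriv)
  with * show "((\<lambda>s. f (s, snd p)) has_real_derivative pd_x f p) (at (fst p))" by simp
  have L: "((\<lambda>s. f (fst p, s)) has_derivative (\<lambda>h. D (0, h))) (at (snd p))"
    using has_derivative_compose[OF has_derivative_Pair[OF has_derivative_const has_derivative_ident],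
      of f D "fst p" "snd p" UNIV] assms by simp
  have "(\<lambda>h. D (0, h)) = (*) (D (0, 1))"
  proof
    show "D (0, h) = D (0, 1) * h" for h using scaleR[of h "(0,1)"] by simp
  qed
  with L have *: "((\<lambda>s. f (fst p, s)) has_real_derivative D (0, 1)) (at (snd p))"
    by (simp add: has_field_derivative_def)
  then show "pd_y f p = D (0, 1)" by (simp add: pd_y_def DERIV_imp_deriv)
  with * show "((\<lambda>t. f (fst p, t)) has_real_derivative pd_y f p) (at (snd p))" by simp
qed

lemma pd_const [simp]: "pd_x (\<lambda>p. c) q = 0" "pd_y (\<lambda>p. c) q = 0"
  by (simp_all add: pd_x_def pd_y_def)

lemma pd_proj [simp]: "pd_x fst q = 1" "pd_y fst q = 0" "pd_x snd q = 0" "pd_y snd q = 1"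
  by (simp_all add: pd_x_def pd_y_def)

lemma Ck_on_Suc_prod:
  fixes f :: "real \<times> real \<Rightarrow> real"
  assumes "open S"
  shows "Ck_on (Suc k) f S \<longleftrightarrow> f differentiable_on S \<and> Ck_on k (pd_x f) S \<and> Ck_on k (pd_y f) S"
proof -
  have "pd_x f p = frechet_derivative f (at p) (1, 0)" "pd_y f p = frechet_derivative f (at p) (0, 1)"
    if "f differentiable_on S" "p \<in> S" for p
    using that assms pd_x_eq pd_y_eq
    by (metis differentiable_on_eq_differentiable_at frechet_derivative_works)+
  then show ?thesis
    using Ck_on_cong[OF assms, of "pd_x f" "\<lambda>p. frechet_derivative f (at p) (1, 0)" k]
      Ck_on_cong[OF assms, of "pd_y f" "\<lambda>p. frechet_derivative f (at p) (0, 1)" k]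
    by (auto simp: Basis_prod_def)
qed

declare Ck_on.simps [simp del]

lemma Ck_pd:
  fixes f :: "real \<times> real \<Rightarrow> real"
  assumes "open V" "Ck_on (Suc k) f V"
  shows "Ck_on k (pd_x f) V" "Ck_on k (pd_y f) V"
  using assms by (auto simp: Ck_on_Suc_prod)

lemma Ck_on_differentiable:
  assumes "open V" "Ck_on (Suc k) f V" "p \<in> V"
  shows "f differentiable at p"
  using assms by (auto simp: Ck_on.simps differentiable_on_eq_differentiable_at)

lemma pd_DERIV:
  assumes "open V" "Ck_on (Suc k) f V" "(x, y) \<in> V"
  shows "((\<lambda>t. f (x, t)) has_real_derivative pd_y f (x, y)) (at y)"
    and "((\<lambda>t. f (t, y)) has_real_derivative pd_x f (x, y)) (at x)"
proof -
  obtain D where "(f has_derivative D) (at (x, y))"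
    using Ck_on_differentiable[OF assms] by (auto simp: differentiable_def)
  from pd_y_DERIV[OF this] pd_x_DERIV[OF this]
  show "((\<lambda>t. f (x, t)) has_real_derivative pd_y f (x, y)) (at y)"
    "((\<lambda>t. f (t, y)) has_real_derivative pd_x f (x, y)) (at x)" by simp_all
qed

lemma DERIV_along:
  fixes f :: "real \<times> real \<Rightarrow> real"
  assumes "f differentiable at (x, y x)" "(y has_real_derivative y') (at x)"
  shows "((\<lambda>x. f (x, y x)) has_real_derivative pd_x f (x, y x) + pd_y f (x, y x) * y') (at x)"
proof -
  obtain D where D: "(f has_derivative D) (at (x, y x))"
    using assms(1) by (auto simp: differentiable_def)
  interpret bounded_linear D using D by (rule has_derivative_bounded_linear)
  have "((\<lambda>x. f (x, y x)) has_derivative (\<lambda>h. D (h, y' * h))) (at x)"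
    using has_derivative_compose[OF has_derivative_Pair[OF has_derivative_ident], of y "(*) y'" x UNIV f D] D assms(2)
    by (simp add: has_field_derivative_def)
  moreover have "(\<lambda>h. D (h, y' * h)) = (*) (pd_x f (x, y x) + pd_y f (x, y x) * y')"
  proof
    fix h
    show "D (h, y' * h) = (pd_x f (x, y x) + pd_y f (x, y x) * y') * h"
      using scaleR[of h "(1,0)"] scaleR[of "y' * h" "(0,1)"] add[of "(h,0)" "(0,y' * h)"]
      by (simp add: pd_x_eq[OF D] pd_y_eq[OF D] algebra_simps)
  qed
  ultimately show ?thesis by (simp add: has_field_derivative_def)
qed

lemma Ck_on_along:
  fixes f :: "real \<times> real \<Rightarrow> real"
  assumes "open V" "open I" "\<And>x. x \<in> I \<Longrightarrow> (x, y x) \<in> V"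
    and "Ck_on k f V" "Ck_on k y I"
  shows "Ck_on k (\<lambda>x. f (x, y x)) I"
  using assms(4,5)
proof (induction k arbitrary: f)
  case 0
  then show ?case using assms(3)
    by (auto simp: Ck_on.simps intro!: continuous_on_compose2[of V f] continuous_intros)
next
  case (Suc k)
  have f: "f differentiable at p" if "p \<in> V" for p
    by (rule Ck_on_differentiable[OF assms(1) Suc.prems(1) that])
  have y: "(y has_real_derivative deriv y x) (at x)" if "x \<in> I" for x
    using Suc.prems that by (simp add: Ck_on_Suc_real assms)
  have d: "((\<lambda>x. f (x, y x)) has_real_derivative pd_x f (x, y x) + pd_y f (x, y x) * deriv y x) (at x)"
    if "x \<in> I" for x
    using that assms(3) by (intro DERIV_along f y) auto
  have "Ck_on k (\<lambda>x. pd_x f (x, y x) + pd_y f (x, y x) * deriv y x) I"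
    using Suc.prems Suc.prems(2)[THEN Ck_on_mono, of k]
    by (intro Ck_on_add Ck_on_mult Suc.IH assms) (auto simp: Ck_on_Suc_real Ck_on_Suc_prod assms)
  then have "Ck_on k (deriv (\<lambda>x. f (x, y x))) I"
    by (subst Ck_on_cong[OF assms(2)]) (auto simp: DERIV_imp_deriv[OF d])
  with d show ?case by (simp add: Ck_on_Suc_real assms DERIV_imp_deriv[OF d])
qed

text \<open>Iterated \<open>y\<close>-derivatives of \<open>f\<close> are higher derivatives of the slices of \<open>f\<close>, so
  questions about them reduce to functions of one variable.\<close>

lemma Ck_slice:
  fixes f :: "real \<times> real \<Rightarrow> real"
  assumes "open V" "Ck_on k f V"
  shows "open {t. (x, t) \<in> V}" "Ck_on k (\<lambda>t. f (x, t)) {t. (x, t) \<in> V}"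
proof -
  have "{t. (x, t) \<in> V} = (\<lambda>t. (x, t)) -` V" by auto
  then show o: "open {t. (x, t) \<in> V}"
    using assms(1) by (simp add: open_vimage continuous_intros)
  show "Ck_on k (\<lambda>t. f (x, t)) {t. (x, t) \<in> V}"
    using assms(2)
  proof (induction k arbitrary: f)
    case 0
    then show ?case by (auto simp: Ck_on.simps intro!: continuous_on_compose2[of V f] continuous_intros)
  next
    case (Suc k)
    have d: "((\<lambda>t. f (x, t)) has_real_derivative pd_y f (x, t)) (at t)" if "(x, t) \<in> V" for t
      by (rule pd_DERIV(1)[OF assms(1) Suc.prems that])
    have "Ck_on k (\<lambda>t. pd_y f (x, t)) {t. (x, t) \<in> V}"
      by (intro Suc.IH Ck_pd(2)[OF assms(1) Suc.prems])
    then have "Ck_on k (deriv (\<lambda>t. f (x, t))) {t. (x, t) \<in> V}"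
      by (subst Ck_on_cong[OF o]) (auto simp: DERIV_imp_deriv[OF d])
    with d show ?case by (auto simp: Ck_on_Suc_real[OF o] DERIV_imp_deriv[OF d])
  qed
qed

lemma constant_in_y:
  assumes "convex Y" "\<And>t. t \<in> Y \<Longrightarrow> (g has_real_derivative 0) (at t)" "y \<in> Y" "y' \<in> Y"
  shows "g y = g y'"
proof -
  have "\<exists>c. \<forall>t\<in>Y. g t = c"
    by (rule has_field_derivative_zero_constant[OF assms(1)]) (rule has_field_derivative_at_within[OF assms(2)])
  with assms(3,4) show ?thesis by auto
qed

lemma open_real_interval:
  fixes B :: "real set"
  assumes "open B" "x \<in> B"
  obtains e where "e > 0" "{x - e<..<x + e} \<subseteq> B"
  using assms by (metis open_contains_ball ball_eq_greaterThanLessThan)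

definition box :: "real \<Rightarrow> real \<Rightarrow> real \<Rightarrow> (real \<times> real) set" where
  "box d x y = {x - d<..<x + d} \<times> {y - d<..<y + d}"

lemma open_box [simp]: "open (box d x y)" by (simp add: box_def open_Times)

lemma box_in_open:
  assumes "open V" "(x, y) \<in> V"
  obtains d where "d > 0" "box d x y \<subseteq> V"
proof -
  obtain A B where AB: "open A" "open B" "x \<in> A" "y \<in> B" "A \<times> B \<subseteq> V"
    using assms by (auto simp: open_prod_def)
  obtain e where e: "e > 0" "{x - e<..<x + e} \<subseteq> A"
    using open_real_interval[OF AB(1,3)] .
  obtain e' where e': "e' > 0" "{y - e'<..<y + e'} \<subseteq> B"
    using open_real_interval[OF AB(2,4)] .
  have "box (min e e') x y \<subseteq> V"
  proof -
    have "{x - min e e'<..<x + min e e'} \<subseteq> A" "{y - min e e'<..<y + min e e'} \<subseteq> B"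
      by (rule order.trans[OF _ e(2)], force) (rule order.trans[OF _ e'(2)], force)
    then show ?thesis using AB unfolding box_def by blast
  qed
  then show thesis using e(1) e'(1) by (intro that[of "min e e'"]) auto
qed

lemma in_box_vertical: "d > 0 \<Longrightarrow> \<bar>y - y0\<bar> < d \<Longrightarrow> (x0, y) \<in> box d x0 y0"
  by (auto simp: box_def)

section \<open>Higher derivatives of functions of one variable\<close>

lemma Ck_on_deriv:
  fixes f :: "real \<Rightarrow> real"
  assumes "open S" "Ck_on (Suc k) f S" shows "Ck_on k (deriv f) S"
  using assms by (simp add: Ck_on_Suc_real)

lemma Ck_on_DERIV:
  fixes f :: "real \<Rightarrow> real"
  assumes "open S" "Ck_on k f S" "0 < k" "x \<in> S"
  shows "(f has_real_derivative deriv f x) (at x)"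
  using assms by (cases k) (simp_all add: Ck_on_Suc_real)

lemma Ck_on_higher_deriv:
  fixes f :: "real \<Rightarrow> real"
  assumes "open S" "Ck_on (j + k) f S" shows "Ck_on k ((deriv ^^ j) f) S"
  using assms(2)
proof (induction j arbitrary: k)
  case (Suc j)
  then have "Ck_on (Suc k) ((deriv ^^ j) f) S" by (simp only: add_Suc_shift)
  from Ck_on_deriv[OF assms(1) this] show ?case by simp
qed simp

lemma higher_deriv_cong:
  fixes f :: "real \<Rightarrow> real"
  assumes "open S" "\<And>x. x \<in> S \<Longrightarrow> f x = g x" "x \<in> S"
  shows "(deriv ^^ k) f x = (deriv ^^ k) g x"
  using assms(3)
proof (induction k arbitrary: x)
  case (Suc k)
  then have "\<forall>\<^sub>F t in nhds x. (deriv ^^ k) f t = (deriv ^^ k) g t"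
    using assms(1) by (auto simp: eventually_nhds)
  then show ?case by (auto intro: deriv_cong_ev)
qed (use assms in auto)

lemma higher_deriv_lincomb:
  fixes f g :: "real \<Rightarrow> real"
  assumes "open S" "Ck_on k f S" "Ck_on k g S" "x \<in> S"
  shows "(deriv ^^ k) (\<lambda>x. a * f x + b * g x) x = a * (deriv ^^ k) f x + b * (deriv ^^ k) g x"
  using assms(2-)
proof (induction k arbitrary: x)
  case (Suc k)
  have m: "Ck_on k f S" "Ck_on k g S" using Suc.prems by (auto intro: Ck_on_mono)
  have d: "((deriv ^^ k) f has_real_derivative deriv ((deriv ^^ k) f) x) (at x)"
    "((deriv ^^ k) g has_real_derivative deriv ((deriv ^^ k) g) x) (at x)"
    using Suc.prems by (auto intro!: Ck_on_DERIV[OF assms(1), of 1] Ck_on_higher_deriv assms(1))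
  have "\<forall>\<^sub>F t in nhds x. (deriv ^^ k) (\<lambda>x. a * f x + b * g x) t = a * (deriv ^^ k) f t + b * (deriv ^^ k) g t"
    using assms(1) Suc.IH[OF m] Suc.prems by (auto simp: eventually_nhds)
  then have "deriv ((deriv ^^ k) (\<lambda>x. a * f x + b * g x)) x = deriv (\<lambda>t. a * (deriv ^^ k) f t + b * (deriv ^^ k) g t) x"
    by (intro deriv_cong_ev) auto
  also have "\<dots> = a * deriv ((deriv ^^ k) f) x + b * deriv ((deriv ^^ k) g) x"
    by (rule DERIV_imp_deriv) (auto intro!: derivative_eq_intros d)
  finally show ?case by simp
qed simp

lemma higher_deriv_add:
  fixes f g :: "real \<Rightarrow> real"
  assumes "open S" "Ck_on k f S" "Ck_on k g S" "x \<in> S"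
  shows "(deriv ^^ k) (\<lambda>x. f x + g x) x = (deriv ^^ k) f x + (deriv ^^ k) g x"
  using higher_deriv_lincomb[OF assms, of 1 1] by simp

lemma deriv_mult_on:
  fixes f g :: "real \<Rightarrow> real"
  assumes "open S" "Ck_on 1 f S" "Ck_on 1 g S" "x \<in> S"
  shows "deriv (\<lambda>x. f x * g x) x = deriv f x * g x + f x * deriv g x"
  by (rule DERIV_imp_deriv)
    (use assms Ck_on_DERIV[of S 1] in \<open>auto intro!: derivative_eq_intros\<close>)

lemma higher_deriv_Suc: "(deriv ^^ Suc k) f = (deriv ^^ k) (deriv f)"
  by (simp add: funpow_swap1)

lemma higher_deriv_mult:
  fixes f g :: "real \<Rightarrow> real"
  assumes "open S" "Ck_on k f S" "Ck_on k g S" "x \<in> S"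
  shows "(deriv ^^ k) (\<lambda>x. f x * g x) x = (\<Sum>i\<le>k. real (k choose i) * (deriv ^^ i) f x * (deriv ^^ (k - i)) g x)"
  using assms(2,3)
proof (induction k arbitrary: f g)
  case (Suc k)
  have m: "Ck_on k f S" "Ck_on k g S" "Ck_on 1 f S" "Ck_on 1 g S"
    using Suc.prems by (auto intro: Ck_on_mono)
  have m': "Ck_on k (deriv f) S" "Ck_on k (deriv g) S"
    using Suc.prems by (auto intro: Ck_on_deriv assms)
  have "(deriv ^^ Suc k) (\<lambda>x. f x * g x) x = (deriv ^^ k) (\<lambda>x. deriv f x * g x + f x * deriv g x) x"
    unfolding higher_deriv_Suc
    by (rule higher_deriv_cong[OF assms(1) _ assms(4)]) (simp add: deriv_mult_on[OF assms(1) m(3,4)])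
  also have "\<dots> = (deriv ^^ k) (\<lambda>x. deriv f x * g x) x + (deriv ^^ k) (\<lambda>x. f x * deriv g x) x"
    by (rule higher_deriv_add[OF assms(1) _ _ assms(4)]) (auto intro: Ck_on_mult assms m m')
  also have "(deriv ^^ k) (\<lambda>x. deriv f x * g x) x =
     (\<Sum>i\<le>k. real (k choose i) * (deriv ^^ Suc i) f x * (deriv ^^ (k - i)) g x)" (is "_ = ?A")
    by (simp add: Suc.IH m m' funpow_swap1)
  also have "(deriv ^^ k) (\<lambda>x. f x * deriv g x) x =
     (\<Sum>i\<le>k. real (k choose i) * (deriv ^^ i) f x * (deriv ^^ (Suc k - i)) g x)" (is "_ = ?B")
    by (auto simp add: Suc.IH m m' Suc_diff_le higher_deriv_Suc simp del: funpow.simps intro!: sum.cong)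
  also have "?A = (\<Sum>i\<in>{1..Suc k}. real (k choose (i - 1)) * (deriv ^^ i) f x * (deriv ^^ (Suc k - i)) g x)"
    by (rule sum.reindex_bij_witness[of _ "\<lambda>i. i - 1" Suc]) auto
  also have "\<dots> = (\<Sum>i\<le>Suc k. (if i = 0 then 0 else real (k choose (i - 1))) * (deriv ^^ i) f x * (deriv ^^ (Suc k - i)) g x)"
    by (rule sum.mono_neutral_cong_left) auto
  also have "?B = (\<Sum>i\<le>Suc k. real (k choose i) * (deriv ^^ i) f x * (deriv ^^ (Suc k - i)) g x)"
    by (rule sum.mono_neutral_cong_left) auto
  also have "(\<Sum>i\<le>Suc k. (if i = 0 then 0 else real (k choose (i - 1))) * (deriv ^^ i) f x * (deriv ^^ (Suc k - i)) g x) + \<dots>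
     = (\<Sum>i\<le>Suc k. real (Suc k choose i) * (deriv ^^ i) f x * (deriv ^^ (Suc k - i)) g x)"
    unfolding sum.distrib[symmetric]
  proof (rule sum.cong[OF refl])
    fix i
    show "(if i = 0 then 0 else real (k choose (i - 1))) * (deriv ^^ i) f x * (deriv ^^ (Suc k - i)) g x
       + real (k choose i) * (deriv ^^ i) f x * (deriv ^^ (Suc k - i)) g x
       = real (Suc k choose i) * (deriv ^^ i) f x * (deriv ^^ (Suc k - i)) g x"
      by (cases i) (simp_all add: algebra_simps)
  qed
  finally show ?case .
qed simp

lemma higher_deriv_zero: "(deriv ^^ k) (\<lambda>t. 0 :: real) = (\<lambda>t. 0)"
proof (induction k)
  case (Suc k)
  then show ?case by simp
qed simp

lemma higher_deriv_centred_power: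
  "j \<le> n \<Longrightarrow> (deriv ^^ j) (\<lambda>t. (t - x) ^ n) t = fact n / fact (n - j) * (t - x) ^ (n - j)" for x t :: real
proof (induction j arbitrary: t)
  case (Suc j)
  have "(deriv ^^ Suc j) (\<lambda>t. (t - x) ^ n) t = deriv (\<lambda>t. fact n / fact (n - j) * (t - x) ^ (n - j)) t"
    using Suc by (simp add: ext[of "(deriv ^^ j) (\<lambda>t. (t - x) ^ n)" "\<lambda>t. fact n / fact (n - j) * (t - x) ^ (n - j)"])
  also have "\<dots> = fact n / fact (n - j) * (real (n - j) * (t - x) ^ (n - j - 1))"
    by (rule DERIV_imp_deriv) (auto intro!: derivative_eq_intros)
  also have "\<dots> = fact n / fact (n - Suc j) * (t - x) ^ (n - Suc j)"
  proof -
    have "n - j = Suc (n - Suc j)" using Suc.prems by simp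
    then show ?thesis by (simp add: field_simps del: of_nat_Suc)
  qed
  finally show ?case .
qed simp

lemma higher_deriv_centred_power_zero: "n < j \<Longrightarrow> (deriv ^^ j) (\<lambda>t. (t - x) ^ n) = (\<lambda>t. 0)" for x :: real
proof (induction j)
  case (Suc j)
  show ?case
  proof (cases "j = n")
    case True
    have "(deriv ^^ j) (\<lambda>t. (t - x) ^ n) = (\<lambda>t. fact n)"
      using higher_deriv_centred_power[of j n x] True by (simp add: fun_eq_iff)
    then have "(deriv ^^ Suc j) (\<lambda>t. (t - x) ^ n) = deriv (\<lambda>t. fact n)" by simp
    then show ?thesis by (simp only:) (simp add: fun_eq_iff)
  next
    case False
    with Suc have "(deriv ^^ j) (\<lambda>t. (t - x) ^ n) = (\<lambda>t. 0)" by simp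
    then have "(deriv ^^ Suc j) (\<lambda>t. (t - x) ^ n) = deriv (\<lambda>t. 0)" by simp
    then show ?thesis by (simp only:) (simp add: fun_eq_iff)
  qed
qed simp

lemma Ck_centred_power: "open I \<Longrightarrow> Ck_on k (\<lambda>t. c * (t - x) ^ n) I" for x :: real
  by (intro Ck_on_mult Ck_on_const Ck_on_power Ck_on_diff Ck_on_bounded_linear bounded_linear_ident)

text \<open>Adding \<open>c (t - x)\<^sup>m / m!\<close> changes the derivative of order \<open>m\<close> at \<open>x\<close> by \<open>c\<close> and no other.
  All information about the equations is extracted with such perturbations of curves.\<close>

lemma higher_deriv_perturb:
  fixes y :: "real \<Rightarrow> real"
  assumes "open I" "Ck_on n y I" "x \<in> I" "j \<le> n"
  shows "(deriv ^^ j) (\<lambda>t. y t + c / fact m * (t - x) ^ m) x = (deriv ^^ j) y x + (if j = m then c else 0)"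
proof -
  have "(deriv ^^ j) (\<lambda>t. y t + c / fact m * (t - x) ^ m) x
     = (deriv ^^ j) y x + c / fact m * (deriv ^^ j) (\<lambda>t. (t - x) ^ m) x"
    using higher_deriv_lincomb[OF assms(1) _ _ assms(3), of j y "\<lambda>t. (t - x) ^ m" 1 "c / fact m"]
      assms Ck_centred_power[of I j 1] by (auto intro: Ck_on_mono)
  then show ?thesis
    by (cases "j \<le> m") (simp_all add: higher_deriv_centred_power higher_deriv_centred_power_zero)
qed

section \<open>Jets of a function along a curve\<close>

text \<open>Equality of \<open>k\<close>-jets at a point. It makes precise that an expression "depends only on the
  derivatives of order at most \<open>k\<close>" without introducing jet variables.\<close>

definition jet_eq :: "nat \<Rightarrow> (real \<Rightarrow> real) \<Rightarrow> (real \<Rightarrow> real) \<Rightarrow> real \<Rightarrow> bool" where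
  "jet_eq k u v x \<longleftrightarrow> (\<forall>j\<le>k. (deriv ^^ j) u x = (deriv ^^ j) v x)"

lemma jet_eq_mono: "jet_eq k u v x \<Longrightarrow> j \<le> k \<Longrightarrow> jet_eq j u v x"
  by (auto simp: jet_eq_def)

lemma jet_eqD: "jet_eq k u v x \<Longrightarrow> j \<le> k \<Longrightarrow> (deriv ^^ j) u x = (deriv ^^ j) v x"
  by (auto simp: jet_eq_def)

lemma jet_eq_value: "jet_eq k u v x \<Longrightarrow> u x = v x"
  using jet_eqD[of k u v x 0] by simp

lemma jet_eq_deriv: "jet_eq (Suc k) u v x \<Longrightarrow> jet_eq k (deriv u) (deriv v) x"
  unfolding jet_eq_def by (metis Suc_le_mono higher_deriv_Suc)

context
  fixes I :: "real set" and k :: nat and u u' v v' :: "real \<Rightarrow> real" and x :: real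
  assumes I: "open I" "x \<in> I"
    and C: "Ck_on k u I" "Ck_on k u' I" "Ck_on k v I" "Ck_on k v' I"
begin

lemma jet_mult:
  assumes "jet_eq k u u' x" "jet_eq k v v' x"
  shows "(deriv ^^ k) (\<lambda>x. u x * v x) x = (deriv ^^ k) (\<lambda>x. u' x * v' x) x"
  using assms by (simp add: higher_deriv_mult[OF I(1) _ _ I(2)] C jet_eq_def)

text \<open>In the Leibniz formula the top derivative of \<open>v\<close> occurs only in the term \<open>u v\<^sup>(\<^sup>k\<^sup>)\<close>.\<close>

lemma jet_mult_diff:
  assumes "jet_eq k u u' x" "\<And>j. j < k \<Longrightarrow> (deriv ^^ j) v x = (deriv ^^ j) v' x"
  shows "(deriv ^^ k) (\<lambda>x. u' x * v' x) x - (deriv ^^ k) (\<lambda>x. u x * v x) x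
    = u x * ((deriv ^^ k) v' x - (deriv ^^ k) v x)"
proof -
  let ?d = "\<lambda>i. real (k choose i) * (deriv ^^ i) u' x * (deriv ^^ (k - i)) v' x
      - real (k choose i) * (deriv ^^ i) u x * (deriv ^^ (k - i)) v x"
  have "(deriv ^^ k) (\<lambda>x. u' x * v' x) x - (deriv ^^ k) (\<lambda>x. u x * v x) x = (\<Sum>i\<le>k. ?d i)"
    by (simp add: higher_deriv_mult[OF I(1) _ _ I(2)] C sum_subtractf)
  also have "\<dots> = (\<Sum>i\<in>{0}. ?d i)"
    using assms(1) by (intro sum.mono_neutral_right) (auto simp: assms(2) jet_eq_def)
  finally show ?thesis using jet_eq_value[OF assms(1)] by (simp add: algebra_simps)
qed

end

lemma jet_mult_eq:
  assumes "open I" "x \<in> I" "Ck_on k u I" "Ck_on k u' I" "Ck_on k v I" "Ck_on k v' I"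
    "jet_eq k u u' x" "jet_eq k v v' x"
  shows "jet_eq k (\<lambda>x. u x * v x) (\<lambda>x. u' x * v' x) x"
  unfolding jet_eq_def
proof (intro allI impI)
  fix j assume "j \<le> k"
  with assms show "(deriv ^^ j) (\<lambda>x. u x * v x) x = (deriv ^^ j) (\<lambda>x. u' x * v' x) x"
    by (intro jet_mult[of I]) (auto intro: Ck_on_mono jet_eq_mono)
qed

definition along :: "(real \<times> real \<Rightarrow> real) \<Rightarrow> (real \<Rightarrow> real) \<Rightarrow> real \<Rightarrow> real" where
  "along f y = (\<lambda>x. f (x, y x))"

text \<open>The regularity and range conditions of \<^const>\<open>curve_in\<close>, but on an arbitrary open set
  instead of a bounded interval, so that domains can be cut down to preimages of open sets.\<close>

definition smooth_curve :: "nat \<Rightarrow> (real \<times> real) set \<Rightarrow> real set \<Rightarrow> (real \<Rightarrow> real) \<Rightarrow> bool" where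
  "smooth_curve n V I y \<longleftrightarrow> open V \<and> open I \<and> Ck_on n y I \<and> (\<forall>x\<in>I. (x, y x) \<in> V)"

lemma smooth_curveD:
  assumes "smooth_curve n V I y"
  shows "open V" "open I" "Ck_on n y I" "\<And>x. x \<in> I \<Longrightarrow> (x, y x) \<in> V"
  using assms by (auto simp: smooth_curve_def)

lemma smooth_curve_mono: "smooth_curve n V I y \<Longrightarrow> k \<le> n \<Longrightarrow> smooth_curve k V I y"
  by (auto simp: smooth_curve_def intro: Ck_on_mono)

lemma smooth_curve_subset: "smooth_curve n V I y \<Longrightarrow> open K \<Longrightarrow> K \<subseteq> I \<Longrightarrow> smooth_curve n V K y"
  by (auto simp: smooth_curve_def intro: Ck_on_subset)

text \<open>Where the graph leaves \<open>V\<close>, the parameter is dropped from the domain. This is how curves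
  with prescribed jets are obtained without estimates.\<close>

lemma smooth_curve_restrict:
  assumes "open V" "open I" "Ck_on n y I"
  shows "smooth_curve n V {t \<in> I. (t, y t) \<in> V} y"
proof -
  have "open (I \<inter> (\<lambda>t. (t, y t)) -` V)"
    using assms by (intro continuous_open_preimage continuous_intros Ck_on_imp_continuous_on[of n])
  moreover have "I \<inter> (\<lambda>t. (t, y t)) -` V = {t \<in> I. (t, y t) \<in> V}" by auto
  ultimately show ?thesis
    using assms by (auto simp: smooth_curve_def intro: Ck_on_subset)
qed

lemma smooth_curve_perturb:
  fixes c x :: real
  assumes "smooth_curve n V I y" "x \<in> I" "m > 0"
  defines "y' \<equiv> \<lambda>t. y t + c / fact m * (t - x) ^ m"
  obtains K where "x \<in> K" "K \<subseteq> I" "smooth_curve n V K y" "smooth_curve n V K y'"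
proof (rule that)
  note D = smooth_curveD[OF assms(1)]
  let ?K = "{t \<in> I. (t, y' t) \<in> V}"
  have "Ck_on n y' I" unfolding y'_def
    using D by (intro Ck_on_add Ck_centred_power) auto
  then show y': "smooth_curve n V ?K y'"
    by (intro smooth_curve_restrict D)
  show "smooth_curve n V ?K y"
    by (rule smooth_curve_subset[OF assms(1) smooth_curveD(2)[OF y']]) auto
  show "x \<in> ?K" using D(4) assms(2,3) by (simp add: y'_def power_0_left)
qed auto

lemma curve_with_slope:
  fixes s x0 :: real
  assumes V: "open V" and q: "(x0, y0) \<in> V"
  obtains I where "x0 \<in> I" "smooth_curve n V I (\<lambda>t. y0 + s * (t - x0))"
proof -
  let ?y = "\<lambda>t. y0 + s * (t - x0) ^ 1"
  have "Ck_on n ?y UNIV" by (intro Ck_on_add Ck_on_const Ck_centred_power) auto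
  from smooth_curve_restrict[OF V _ this] have "smooth_curve n V {t \<in> UNIV. (t, ?y t) \<in> V} ?y" by simp
  then show thesis by (intro that[of "{t \<in> UNIV. (t, ?y t) \<in> V}"]) (use q in auto)
qed

lemma deriv_line: "deriv (\<lambda>t. y0 + s * (t - x0)) t = s" for s :: real
  by (rule DERIV_imp_deriv) (auto intro!: derivative_eq_intros)

lemma Ck_along:
  assumes "smooth_curve n V I y" "Ck_on k f V" "k \<le> n"
  shows "Ck_on k (along f y) I"
  unfolding along_def using smooth_curveD[OF assms(1)] assms(2,3)
  by (auto intro: Ck_on_along Ck_on_mono)

lemma deriv_along:
  assumes "smooth_curve (Suc k) V I y" "Ck_on (Suc k) f V" "x \<in> I"
  shows "deriv (along f y) x = along (pd_x f) y x + along (pd_y f) y x * deriv y x"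
  unfolding along_def using smooth_curveD[OF assms(1)] assms
  by (intro DERIV_imp_deriv DERIV_along) (auto intro: Ck_on_differentiable Ck_on_DERIV)

lemma higher_deriv_along_Suc:
  assumes y: "smooth_curve (Suc k) V I y" and f: "Ck_on (Suc k) f V" and x: "x \<in> I"
  shows "(deriv ^^ Suc k) (along f y) x =
    (deriv ^^ k) (along (pd_x f) y) x + (deriv ^^ k) (\<lambda>x. along (pd_y f) y x * deriv y x) x"
proof -
  note D = smooth_curveD[OF y]
  note y' = smooth_curve_mono[OF y, of k]
  have "(deriv ^^ Suc k) (along f y) x = (deriv ^^ k) (\<lambda>x. along (pd_x f) y x + along (pd_y f) y x * deriv y x) x"
    unfolding higher_deriv_Suc
    by (rule higher_deriv_cong[OF D(2) _ x]) (rule deriv_along[OF y f])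
  also have "\<dots> = (deriv ^^ k) (along (pd_x f) y) x + (deriv ^^ k) (\<lambda>x. along (pd_y f) y x * deriv y x) x"
    using D y' f x
    by (intro higher_deriv_add[of I]) (auto intro!: Ck_on_mult Ck_along[of k V] Ck_pd Ck_on_deriv)
  finally show ?thesis .
qed

text \<open>By the chain rule a derivative of order \<open>k + 1\<close> of \<open>f(x, y(x))\<close> is a derivative of order \<open>k\<close>
  of an expression in \<open>f\<^sub>x\<close>, \<open>f\<^sub>y\<close> along the curve and \<open>y'\<close>, so induction over all \<open>f\<close> applies.\<close>

lemma jet_along:
  assumes "smooth_curve k V I y" "smooth_curve k V I y'" "Ck_on k f V" "x \<in> I" "jet_eq k y y' x"
  shows "(deriv ^^ k) (along f y) x = (deriv ^^ k) (along f y') x"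
  using assms
proof (induction k arbitrary: f rule: less_induct)
  case (less k)
  show ?case
  proof (cases k)
    case 0
    then show ?thesis using jet_eq_value[OF less.prems(5)] by (simp add: along_def)
  next
    case (Suc m)
    note y = less.prems(1,2)[unfolded Suc] and f = less.prems(3)[unfolded Suc] and x = less.prems(4)
    note D = smooth_curveD[OF y(1)] smooth_curveD[OF y(2)]
    have IH: "jet_eq m (along g y) (along g y') x" if "Ck_on m g V" for g
      unfolding jet_eq_def
    proof (intro allI impI)
      fix j assume "j \<le> m"
      then show "(deriv ^^ j) (along g y) x = (deriv ^^ j) (along g y') x"
        using Suc that less.prems
        by (intro less.IH) (auto intro: smooth_curve_mono Ck_on_mono jet_eq_mono)
    qed
    have "(deriv ^^ m) (along (pd_x f) y) x = (deriv ^^ m) (along (pd_x f) y') x"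
      by (rule jet_eqD[OF IH order_refl]) (rule Ck_pd[OF D(1) f])
    moreover have "(deriv ^^ m) (\<lambda>x. along (pd_y f) y x * deriv y x) x = (deriv ^^ m) (\<lambda>x. along (pd_y f) y' x * deriv y' x) x"
      using D f x less.prems(5) unfolding Suc
      by (intro jet_mult[OF D(2) x] IH Ck_along[OF y(1)] Ck_along[OF y(2)] jet_eq_deriv Ck_on_deriv Ck_pd) auto
    ultimately show ?thesis
      unfolding Suc higher_deriv_along_Suc[OF y(1) f x] higher_deriv_along_Suc[OF y(2) f x] by simp
  qed
qed

lemma jet_along_eq:
  assumes "smooth_curve n V I y" "smooth_curve n V I y'" "Ck_on k f V" "x \<in> I" "jet_eq k y y' x" "k \<le> n"
  shows "jet_eq k (along f y) (along f y') x"
  unfolding jet_eq_def using assms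
  by (auto intro!: jet_along intro: smooth_curve_mono Ck_on_mono jet_eq_mono)

lemma jet_along_diff:
  assumes y: "smooth_curve (Suc k) V I y" "smooth_curve (Suc k) V I y'"
    and f: "Ck_on (Suc k) f V" and x: "x \<in> I" and j: "jet_eq k y y' x"
  shows "(deriv ^^ Suc k) (along f y') x - (deriv ^^ Suc k) (along f y) x =
     pd_y f (x, y x) * ((deriv ^^ Suc k) y' x - (deriv ^^ Suc k) y x)"
proof -
  note D = smooth_curveD[OF y(1)] smooth_curveD[OF y(2)]
  have "(deriv ^^ k) (along (pd_x f) y) x = (deriv ^^ k) (along (pd_x f) y') x"
    by (rule jet_eqD[OF jet_along_eq[OF y _ x j] order_refl]) (auto intro: Ck_pd[OF D(1) f])
  moreover have "(deriv ^^ k) (\<lambda>x. along (pd_y f) y' x * deriv y' x) x - (deriv ^^ k) (\<lambda>x. along (pd_y f) y x * deriv y x) x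
    = along (pd_y f) y x * ((deriv ^^ k) (deriv y') x - (deriv ^^ k) (deriv y) x)"
    using D f x j
    by (intro jet_mult_diff[OF D(2) x] Ck_along[OF y(1)] Ck_along[OF y(2)] jet_eq_deriv Ck_on_deriv Ck_pd jet_along_eq[OF y])
      (auto simp: higher_deriv_Suc[symmetric] simp del: funpow.simps intro: jet_eqD)
  ultimately show ?thesis
    unfolding higher_deriv_along_Suc[OF y(1) f x] higher_deriv_along_Suc[OF y(2) f x]
    by (simp add: higher_deriv_Suc along_def del: funpow.simps)
qed

text \<open>For \<open>k \<ge> 1\<close> the derivative of order \<open>k + 2\<close> is affine in \<open>y\<^sup>(\<^sup>k\<^sup>+\<^sup>1\<^sup>)\<close> too. Up to the order of the
  mixed derivatives, which is left as it arises, the slope is \<open>(k + 2) d/dx f\<^sub>y(x, y(x))\<close>. For \<open>k = 0\<close>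
  there would be a term quadratic in \<open>y'\<close>: this is where equations of order two differ from those
  of higher order.\<close>

lemma jet_along_diff2:
  assumes y: "smooth_curve (Suc (Suc k)) V I y" "smooth_curve (Suc (Suc k)) V I y'"
    and f: "Ck_on (Suc (Suc k)) f V" and x: "x \<in> I" and j: "jet_eq k y y' x" and k: "k \<ge> 1"
  shows "(deriv ^^ Suc (Suc k)) (along f y') x - (deriv ^^ Suc (Suc k)) (along f y) x =
     (pd_y (pd_x f) (x, y x) + pd_y (pd_y f) (x, y x) * deriv y x
       + real (Suc k) * (pd_x (pd_y f) (x, y x) + pd_y (pd_y f) (x, y x) * deriv y x))
       * ((deriv ^^ Suc k) y' x - (deriv ^^ Suc k) y x)
     + pd_y f (x, y x) * ((deriv ^^ Suc (Suc k)) y' x - (deriv ^^ Suc (Suc k)) y x)"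
proof -
  note D = smooth_curveD[OF y(1)] smooth_curveD[OF y(2)]
  have y1: "smooth_curve (Suc k) V I y" "smooth_curve (Suc k) V I y'"
    using y by (auto intro: smooth_curve_mono)
  note P = Ck_pd[OF D(1) f]
  let ?U = "along (pd_y f) y" and ?U' = "along (pd_y f) y'"
  let ?d = "(deriv ^^ Suc k) y' x - (deriv ^^ Suc k) y x"
  have x1: "(deriv ^^ Suc k) (along (pd_x f) y') x - (deriv ^^ Suc k) (along (pd_x f) y) x = pd_y (pd_x f) (x, y x) * ?d"
    by (rule jet_along_diff[OF y1 P(1) x j])
  have U1: "(deriv ^^ Suc k) ?U' x - (deriv ^^ Suc k) ?U x = pd_y (pd_y f) (x, y x) * ?d"
    by (rule jet_along_diff[OF y1 P(2) x j])
  have U0: "jet_eq k ?U ?U' x"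
    by (rule jet_along_eq[OF y1 _ x j]) (auto intro: Ck_on_mono P)
  have dU: "deriv ?U x = pd_x (pd_y f) (x, y x) + pd_y (pd_y f) (x, y x) * deriv y x"
    using deriv_along[OF y1(1) P(2) x] by (simp add: along_def)
  let ?D = "\<lambda>i. real (Suc k choose i) * (deriv ^^ i) ?U' x * (deriv ^^ (Suc k - i)) (deriv y') x
      - real (Suc k choose i) * (deriv ^^ i) ?U x * (deriv ^^ (Suc k - i)) (deriv y) x"
  have "(deriv ^^ Suc k) (\<lambda>x. ?U' x * deriv y' x) x - (deriv ^^ Suc k) (\<lambda>x. ?U x * deriv y x) x = (\<Sum>i\<le>Suc k. ?D i)"
    using D P by (simp add: higher_deriv_mult[OF D(2) _ _ x] Ck_along[OF y(1)] Ck_along[OF y(2)] Ck_on_deriv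
       sum_subtractf del: funpow.simps)
  \<comment> \<open>The derivatives of order \<open>k + 1\<close> and \<open>k + 2\<close> of \<open>y\<close> enter through \<open>y'\<close> for \<open>i \<le> 1\<close>, and through \<open>f\<^sub>y\<close> for \<open>i = k + 1\<close>.\<close>
  also have "\<dots> = (\<Sum>i\<in>{0, 1, Suc k}. ?D i)"
  proof -
    have "?D i = 0" if "i \<le> Suc k" "i \<notin> {0, 1, Suc k}" for i
    proof -
      have "(deriv ^^ (Suc k - i)) (deriv y) x = (deriv ^^ (Suc k - i)) (deriv y') x"
        unfolding higher_deriv_Suc[symmetric] using that by (intro jet_eqD[OF j]) auto
      moreover have "(deriv ^^ i) ?U x = (deriv ^^ i) ?U' x"
        using that by (intro jet_eqD[OF U0]) auto
      ultimately show ?thesis by simp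
    qed
    then show ?thesis by (intro sum.mono_neutral_right) auto
  qed
  also have "\<dots> = ?D 0 + ?D 1 + ?D (Suc k)" using k by simp
  also have "?D 0 = pd_y f (x, y x) * ((deriv ^^ Suc (Suc k)) y' x - (deriv ^^ Suc (Suc k)) y x)"
    using jet_eq_value[OF U0] by (simp add: higher_deriv_Suc along_def algebra_simps del: funpow.simps)
  also have "?D 1 = real (Suc k) * deriv ?U x * ?d"
  proof -
    have "deriv ?U x = deriv ?U' x" using jet_eqD[OF U0 k] by simp
    moreover have "(deriv ^^ (Suc k - 1)) (deriv y) x = (deriv ^^ Suc k) y x" for y
      by (simp add: higher_deriv_Suc del: funpow.simps)
    ultimately show ?thesis by (simp add: algebra_simps del: funpow.simps) (simp add: algebra_simps)
  qed
  also have "?D (Suc k) = pd_y (pd_y f) (x, y x) * ?d * deriv y x"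
  proof -
    have "deriv y x = deriv y' x" using jet_eqD[OF j k] by simp
    then show ?thesis unfolding U1[symmetric] by (simp add: algebra_simps)
  qed
  finally show ?thesis
    unfolding higher_deriv_along_Suc[OF y(1) f x] higher_deriv_along_Suc[OF y(2) f x] dU
    using x1 by (simp add: algebra_simps del: funpow.simps)
qed

section \<open>Jets of the iterated operator\<close>

abbreviation Om :: "(real \<times> real \<Rightarrow> real) \<Rightarrow> (real \<Rightarrow> real) \<Rightarrow> nat \<Rightarrow> real \<Rightarrow> real" where
  "Om F y k \<equiv> Omega_iter F k y"

lemma Om_0 [simp]: "Om F y 0 = y" by (simp add: Omega_iter_def)

lemma Om_Suc: "Om F y (Suc k) = (\<lambda>x. deriv (Om F y k) x + along F y x * Om F y k x)"
  by (simp add: Omega_iter_def Omega_def along_def)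

lemma Ck_Om:
  assumes y: "smooth_curve n V I y" and F: "Ck_on n F V" and "k + j \<le> n"
  shows "Ck_on j (Om F y k) I"
  using assms(3)
proof (induction k arbitrary: j)
  case 0
  then show ?case using smooth_curveD[OF y] by (auto intro: Ck_on_mono)
next
  case (Suc k)
  have "Ck_on (Suc j) (Om F y k) I" "Ck_on j (Om F y k) I"
    using Suc.IH[of "Suc j"] Suc.IH[of j] Suc.prems by auto
  then show ?case unfolding Om_Suc using Suc.prems smooth_curveD[OF y]
    by (auto intro!: Ck_on_add Ck_on_mult Ck_on_deriv Ck_along[OF y] intro: Ck_on_mono[OF F])
qed

lemma higher_deriv_Om_Suc:
  assumes y: "smooth_curve n V I y" and F: "Ck_on n F V" and "Suc k + j \<le> n" "x \<in> I"
  shows "(deriv ^^ j) (Om F y (Suc k)) x = (deriv ^^ Suc j) (Om F y k) x + (deriv ^^ j) (\<lambda>x. along F y x * Om F y k x) x"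
  unfolding Om_Suc higher_deriv_Suc using smooth_curveD[OF y] assms
  by (intro higher_deriv_add[of I]) (auto intro!: Ck_on_mult Ck_on_deriv Ck_Om[OF y F] Ck_along[OF y] intro: Ck_on_mono[OF F])

context
  fixes n :: nat and V :: "(real \<times> real) set" and I :: "real set" and y y' :: "real \<Rightarrow> real"
    and F :: "real \<times> real \<Rightarrow> real" and x :: real
  assumes y: "smooth_curve n V I y" and y': "smooth_curve n V I y'"
    and F: "Ck_on n F V" and x: "x \<in> I"
begin

lemma jet_Om:
  assumes "k + j \<le> n" "jet_eq (k + j) y y' x"
  shows "jet_eq j (Om F y k) (Om F y' k) x"
  using assms
proof (induction k arbitrary: j)
  case 0
  then show ?case by simp
next
  case (Suc k)
  have 1: "jet_eq (Suc j) (Om F y k) (Om F y' k) x" using Suc by simp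
  have 2: "jet_eq j (\<lambda>x. along F y x * Om F y k x) (\<lambda>x. along F y' x * Om F y' k x) x"
    using Suc.prems 1 smooth_curveD[OF y] x
    by (intro jet_mult_eq[of I] jet_along_eq[OF y y'] Ck_Om[OF y F] Ck_Om[OF y' F] Ck_along[OF y] Ck_along[OF y'])
      (auto intro: Ck_on_mono[OF F] jet_eq_mono)
  show ?case unfolding jet_eq_def
  proof (intro allI impI)
    fix i assume "i \<le> j"
    then have "(deriv ^^ Suc i) (Om F y k) x = (deriv ^^ Suc i) (Om F y' k) x"
      "(deriv ^^ i) (\<lambda>x. along F y x * Om F y k x) x = (deriv ^^ i) (\<lambda>x. along F y' x * Om F y' k x) x"
      by (auto intro!: jet_eqD[OF 1] jet_eqD[OF 2] simp del: funpow.simps)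
    then show "(deriv ^^ i) (Om F y (Suc k)) x = (deriv ^^ i) (Om F y' (Suc k)) x"
      using Suc.prems \<open>i \<le> j\<close> by (simp add: higher_deriv_Om_Suc[OF y F] higher_deriv_Om_Suc[OF y' F] x del: funpow.simps)
  qed
qed

text \<open>All derivatives of order \<open>j\<close> of \<open>\<Omega>\<^sup>k[y]\<close> have the form \<open>y\<^sup>(\<^sup>k\<^sup>+\<^sup>j\<^sup>)\<close> plus terms of lower order.
  The statement is about all \<open>j\<close> because \<open>\<Omega>\<close> differentiates what it is applied to.\<close>

lemma jet_Om_diff:
  assumes "k + j = Suc m" "Suc m \<le> n" "jet_eq m y y' x"
  shows "(deriv ^^ j) (Om F y' k) x - (deriv ^^ j) (Om F y k) x = (deriv ^^ Suc m) y' x - (deriv ^^ Suc m) y x"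
  using assms
proof (induction k arbitrary: j)
  case 0
  then show ?case by simp
next
  case (Suc k)
  have "(deriv ^^ j) (\<lambda>x. along F y x * Om F y k x) x = (deriv ^^ j) (\<lambda>x. along F y' x * Om F y' k x) x"
    using Suc.prems smooth_curveD[OF y] x
    by (intro jet_mult[of I] jet_along_eq[OF y y'] jet_Om Ck_Om[OF y F] Ck_Om[OF y' F] Ck_along[OF y] Ck_along[OF y'])
      (auto intro: Ck_on_mono[OF F] jet_eq_mono)
  with Suc.IH[of "Suc j"] Suc.prems show ?case
    by (simp add: higher_deriv_Om_Suc[OF y F] higher_deriv_Om_Suc[OF y' F] x del: funpow.simps)
qed

text \<open>The coefficient of the derivative of second highest order: each application of \<open>\<Omega>\<close>
  contributes a factor \<open>F\<close>, and the first one also \<open>y F\<^sub>y\<close>, because in \<open>F(x, y) y\<close> the unknown enters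
  through \<open>F\<close> as well.\<close>

lemma jet_Om_diff2:
  assumes "k + j = Suc (Suc m)" "Suc (Suc m) \<le> n" "jet_eq m y y' x"
  shows "(deriv ^^ j) (Om F y' k) x - (deriv ^^ j) (Om F y k) x =
    (deriv ^^ Suc (Suc m)) y' x - (deriv ^^ Suc (Suc m)) y x
    + (real k * F (x, y x) + (if k = 0 then 0 else y x * pd_y F (x, y x))) * ((deriv ^^ Suc m) y' x - (deriv ^^ Suc m) y x)"
  using assms
proof (induction k arbitrary: j)
  case 0
  then show ?case by simp
next
  case (Suc k)
  let ?d = "(deriv ^^ Suc m) y' x - (deriv ^^ Suc m) y x"
  have jk: "k + j = Suc m" using Suc.prems by simp
  have C: "Ck_on j (along F y) I" "Ck_on j (along F y') I" "Ck_on j (Om F y k) I" "Ck_on j (Om F y' k) I"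
    using Suc.prems by (auto intro!: Ck_Om[OF y F] Ck_Om[OF y' F] Ck_along[OF y] Ck_along[OF y'] intro: Ck_on_mono[OF F])
  note D = smooth_curveD[OF y]
  have "(deriv ^^ j) (\<lambda>x. along F y' x * Om F y' k x) x - (deriv ^^ j) (\<lambda>x. along F y x * Om F y k x) x
     = (F (x, y x) + (if k = 0 then y x * pd_y F (x, y x) else 0)) * ?d"
  proof (cases "k = 0")
    case False
    have "(deriv ^^ j) (\<lambda>x. along F y' x * Om F y' k x) x - (deriv ^^ j) (\<lambda>x. along F y x * Om F y k x) x
      = along F y x * ((deriv ^^ j) (Om F y' k) x - (deriv ^^ j) (Om F y k) x)"
    proof (rule jet_mult_diff[OF D(2) x C])
      show "jet_eq j (along F y) (along F y') x" using Suc.prems False jk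
        by (intro jet_along_eq[OF y y' _ x]) (auto intro: Ck_on_mono[OF F] jet_eq_mono)
      show "(deriv ^^ i) (Om F y k) x = (deriv ^^ i) (Om F y' k) x" if "i < j" for i
        using Suc.prems jk that
        by (intro jet_eqD[OF jet_Om order_refl]) (auto intro: jet_eq_mono)
    qed
    with False jet_Om_diff[OF jk] Suc.prems show ?thesis by (simp add: along_def)
  next
    case True
    then have jm: "j = Suc m" using jk by simp
    have yx: "y' x = y x" using jet_eq_value[OF Suc.prems(3)] by simp
    have ym: "smooth_curve (Suc m) V I y" "smooth_curve (Suc m) V I y'"
      using Suc.prems by (auto intro: smooth_curve_mono[OF y] smooth_curve_mono[OF y'])
    let ?D = "\<lambda>i. real (j choose i) * (deriv ^^ i) (along F y') x * (deriv ^^ (j - i)) y' x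
      - real (j choose i) * (deriv ^^ i) (along F y) x * (deriv ^^ (j - i)) y x"
    have JF: "jet_eq m (along F y) (along F y') x"
      using Suc.prems by (intro jet_along_eq[OF y y' _ x]) (auto intro: Ck_on_mono[OF F])
    have "(deriv ^^ j) (\<lambda>x. along F y' x * Om F y' k x) x - (deriv ^^ j) (\<lambda>x. along F y x * Om F y k x) x
      = (\<Sum>i\<le>j. ?D i)"
      using True C by (simp add: higher_deriv_mult[OF D(2) _ _ x] sum_subtractf)
    also have "\<dots> = (\<Sum>i\<in>{0, j}. ?D i)"
    proof -
      have "?D i = 0" if "i \<le> j" "i \<notin> {0, j}" for i
      proof -
        have "i \<le> m" "j - i \<le> m" using that jm by auto
        then show ?thesis
          using jet_eqD[OF JF, of i] jet_eqD[OF Suc.prems(3), of "j - i"] by simp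
      qed
      then show ?thesis by (intro sum.mono_neutral_right) auto
    qed
    also have "\<dots> = ?D 0 + ?D j" by (simp add: jm)
    also have "?D j = ((deriv ^^ Suc m) (along F y') x - (deriv ^^ Suc m) (along F y) x) * y x"
      by (simp add: jm yx left_diff_distrib)
    also have "\<dots> = pd_y F (x, y x) * ?d * y x"
      using Suc.prems by (subst jet_along_diff[OF ym _ x]) (auto intro: Ck_on_mono[OF F])
    also have "?D 0 = F (x, y x) * ?d"
      by (simp add: jm yx along_def algebra_simps)
    finally show ?thesis using True by (simp add: algebra_simps)
  qed
  with Suc.IH[of "Suc j"] Suc.prems show ?case
    by (cases "k = 0") (simp_all add: higher_deriv_Om_Suc[OF y F] higher_deriv_Om_Suc[OF y' F] x algebra_simps del: funpow.simps)
qed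

end

section \<open>Derivatives with respect to a new independent variable\<close>

lemma nonzero_deriv_inj_on:
  fixes z :: "real \<Rightarrow> real"
  assumes d: "\<And>x. x \<in> {s<..<t} \<Longrightarrow> (z has_real_derivative R x) (at x)"
    and R: "\<And>x. x \<in> {s<..<t} \<Longrightarrow> R x \<noteq> 0"
  shows "inj_on z {s<..<t}"
proof (rule linorder_inj_onI)
  fix x y assume "x < y" "x \<in> {s<..<t}" "y \<in> {s<..<t}"
  then have "\<exists>c>x. c < y \<and> z y - z x = (y - x) * R c"
    by (intro MVT2 d) auto
  then obtain c where "x < c" "c < y" "z y - z x = (y - x) * R c" by blast
  moreover from this have "c \<in> {s<..<t}" using \<open>x \<in> {s<..<t}\<close> \<open>y \<in> {s<..<t}\<close> by auto
  ultimately have "z y - z x \<noteq> 0" using R by simp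
  then show "z x \<noteq> z y" by simp
qed auto

text \<open>The differentiability of \<open>w\<close> comes from that of the inverse function of \<open>z\<close>, since
  \<open>w = u \<circ> z\<^sup>-\<^sup>1\<close> on the open image of the interval.\<close>

lemma deriv_reparametrized:
  fixes z u w :: "real \<Rightarrow> real"
  assumes d: "\<And>x. x \<in> {s<..<t} \<Longrightarrow> (z has_real_derivative R x) (at x)"
    and R: "\<And>x. x \<in> {s<..<t} \<Longrightarrow> R x \<noteq> 0"
    and w: "\<And>x. x \<in> {s<..<t} \<Longrightarrow> w (z x) = u x"
    and x: "x \<in> {s<..<t}" and u: "(u has_real_derivative D) (at x)"
  shows "deriv w (z x) = D / R x"
proof -
  let ?I = "{s<..<t}"
  let ?g = "inv_into ?I z"
  have inj: "inj_on z ?I" by (rule nonzero_deriv_inj_on[OF d R])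
  have cont: "continuous_on ?I z"
    using d by (meson DERIV_isCont continuous_at_imp_continuous_on)
  have "open (z ` ?I)"
    using injective_eq_1d_open_map_UNIV[OF cont] inj by (simp add: is_interval_1)
  have "(?g has_derivative (*) (1 / R x)) (at (z x))"
    by (rule has_derivative_inverse_strong[of ?I x z _ "\<lambda>h. R x * h"])
      (use x cont d[OF x] R[OF x] inj in \<open>auto simp: has_field_derivative_def fun_eq_iff\<close>)
  then have g: "(?g has_real_derivative 1 / R x) (at (z x))"
    by (simp only: has_field_derivative_def)
  have "(u has_real_derivative D) (at (?g (z x)))"
    using u inj x by simp
  from DERIV_chain2[OF this g] have "((\<lambda>t. u (?g t)) has_real_derivative D / R x) (at (z x))"
    by simp
  moreover have "u (?g r) = w r" if "r \<in> z ` ?I" for r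
    using that inj w by (metis f_inv_into_f inv_into_into)
  ultimately have "(w has_real_derivative D / R x) (at (z x))"
    using has_field_derivative_transform_within_open[OF _ \<open>open (z ` ?I)\<close>] x by blast
  then show ?thesis by (rule DERIV_imp_deriv)
qed

text \<open>The image of a curve under the transformation, as a function of the new variable; it is
  single-valued because \<open>z\<close> is strictly monotone on the interval.\<close>

lemma image_exists:
  fixes z u :: "real \<Rightarrow> real"
  assumes "\<And>x. x \<in> {s<..<t} \<Longrightarrow> (z has_real_derivative R x) (at x)"
    and "\<And>x. x \<in> {s<..<t} \<Longrightarrow> R x \<noteq> 0"
  shows "\<exists>w. \<forall>x\<in>{s<..<t}. w (z x) = u x"
proof
  show "\<forall>x\<in>{s<..<t}. (\<lambda>r. u (inv_into {s<..<t} z r)) (z x) = u x"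
    using nonzero_deriv_inj_on[OF assms] by simp
qed

text \<open>If \<open>R = dz/dx\<close> and \<open>S = du/dx\<close>, the derivative of order \<open>k + 1\<close> of \<open>u\<close> with respect to \<open>z\<close> is
  \<open>quot_numer R S k / R\<^sup>2\<^sup>k\<^sup>+\<^sup>1\<close>, by the quotient rule. The numerators are tracked separately because
  they remain meaningful where \<open>R\<close> vanishes.\<close>

primrec quot_numer :: "(real \<Rightarrow> real) \<Rightarrow> (real \<Rightarrow> real) \<Rightarrow> nat \<Rightarrow> real \<Rightarrow> real" where
  "quot_numer R S 0 = S"
| "quot_numer R S (Suc k) = (\<lambda>x. R x * deriv (quot_numer R S k) x - real (2 * k + 1) * (quot_numer R S k x * deriv R x))"

lemma Ck_quot_numer:
  assumes "open I" "Ck_on N R I" "Ck_on N S I" "k + j \<le> N"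
  shows "Ck_on j (quot_numer R S k) I"
  using assms(4)
proof (induction k arbitrary: j)
  case 0
  then show ?case using assms by (auto intro: Ck_on_mono)
next
  case (Suc k)
  have "Ck_on (Suc j) (quot_numer R S k) I" "Ck_on j (quot_numer R S k) I"
    using Suc.IH[of "Suc j"] Suc.IH[of j] Suc.prems by auto
  moreover have "Ck_on (Suc j) R I" using Suc.prems by (auto intro: Ck_on_mono[OF assms(2)])
  ultimately show ?case
    by (auto intro!: Ck_on_diff Ck_on_mult Ck_on_deriv assms(1) intro: Ck_on_mono)
qed

lemma higher_deriv_quot_numer_Suc:
  assumes I: "open I" and "Ck_on N R I" "Ck_on N S I" "Suc k + j \<le> N" and x: "x \<in> I"
  shows "(deriv ^^ j) (quot_numer R S (Suc k)) x = (deriv ^^ j) (\<lambda>x. R x * deriv (quot_numer R S k) x) x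
    - real (2 * k + 1) * (deriv ^^ j) (\<lambda>x. quot_numer R S k x * deriv R x) x"
proof -
  have "Ck_on (Suc j) (quot_numer R S k) I" "Ck_on j (quot_numer R S k) I" "Ck_on (Suc j) R I" "Ck_on j R I"
    using assms by (auto intro: Ck_quot_numer[OF I assms(2,3)] Ck_on_mono[OF assms(2)])
  moreover have "quot_numer R S (Suc k) = (\<lambda>x. 1 * (R x * deriv (quot_numer R S k) x) + (- real (2 * k + 1)) * (quot_numer R S k x * deriv R x))"
    by (simp add: fun_eq_iff algebra_simps)
  ultimately have "(deriv ^^ j) (quot_numer R S (Suc k)) x = 1 * (deriv ^^ j) (\<lambda>x. R x * deriv (quot_numer R S k) x) x
    + (- real (2 * k + 1)) * (deriv ^^ j) (\<lambda>x. quot_numer R S k x * deriv R x) x"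
    by (simp only:, intro higher_deriv_lincomb[OF I _ _ x]) (auto simp: Ck_on_mult Ck_on_deriv I)
  then show ?thesis by (simp add: algebra_simps del: quot_numer.simps)
qed

lemma image_higher_deriv:
  fixes z u w :: "real \<Rightarrow> real"
  assumes z: "Ck_on n z {s<..<t}" and u: "Ck_on n u {s<..<t}"
    and R: "\<And>x. x \<in> {s<..<t} \<Longrightarrow> deriv z x \<noteq> 0"
    and w: "\<And>x. x \<in> {s<..<t} \<Longrightarrow> w (z x) = u x"
    and "k < n" and "x \<in> {s<..<t}"
  shows "(deriv ^^ Suc k) w (z x) = quot_numer (deriv z) (deriv u) k x / deriv z x ^ (2 * k + 1)"
  using assms(5,6)
proof (induction k arbitrary: x)
  case 0
  then show ?case
    using deriv_reparametrized[of s t z "deriv z" w u x "deriv u x", OF _ R w] Ck_on_DERIV[OF _ z] Ck_on_DERIV[OF _ u]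
    by simp
next
  case (Suc k)
  let ?I = "{s<..<t}"
  obtain m where n: "n = Suc m" "Suc k \<le> m" using Suc.prems(1) by (cases n) auto
  have C: "Ck_on m (deriv z) ?I" "Ck_on m (deriv u) ?I"
    using z u unfolding n by (auto intro: Ck_on_deriv)
  have N: "(quot_numer (deriv z) (deriv u) k has_real_derivative deriv (quot_numer (deriv z) (deriv u) k) x) (at x)"
    using n Suc.prems by (intro Ck_on_DERIV[of ?I 1] Ck_quot_numer[OF _ C]) auto
  have R': "(deriv z has_real_derivative deriv (deriv z) x) (at x)"
    using n Suc.prems by (intro Ck_on_DERIV[OF _ C(1)]) auto
  have nz: "deriv z x \<noteq> 0" by (rule R) (rule Suc.prems)
  have "deriv ((deriv ^^ Suc k) w) (z x) =
     ((deriv (quot_numer (deriv z) (deriv u) k) x * deriv z x ^ (2 * k + 1)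
       - quot_numer (deriv z) (deriv u) k x * (real (2 * k + 1) * (deriv z x ^ (2 * k) * deriv (deriv z) x)))
      / (deriv z x ^ (2 * k + 1)) ^ 2) / deriv z x"
  proof (rule deriv_reparametrized[of s t z "deriv z" _ "\<lambda>x. quot_numer (deriv z) (deriv u) k x / deriv z x ^ (2 * k + 1)"])
    show "(z has_real_derivative deriv z x) (at x)" if "x \<in> ?I" for x
      using that n by (intro Ck_on_DERIV[OF _ z]) auto
    show "(deriv ^^ Suc k) w (z x) = quot_numer (deriv z) (deriv u) k x / deriv z x ^ (2 * k + 1)" if "x \<in> ?I" for x
      using that Suc.prems by (intro Suc.IH) auto
    show "((\<lambda>x. quot_numer (deriv z) (deriv u) k x / deriv z x ^ (2 * k + 1)) has_real_derivative
      (deriv (quot_numer (deriv z) (deriv u) k) x * deriv z x ^ (2 * k + 1)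
       - quot_numer (deriv z) (deriv u) k x * (real (2 * k + 1) * (deriv z x ^ (2 * k) * deriv (deriv z) x)))
      / (deriv z x ^ (2 * k + 1)) ^ 2) (at x)"
      using nz by (auto intro!: derivative_eq_intros N R' simp: power2_eq_square simp del: power_Suc)
  qed (use R Suc.prems in auto)
  also have "\<dots> = quot_numer (deriv z) (deriv u) (Suc k) x / deriv z x ^ (2 * Suc k + 1)"
    using nz by (simp add: field_simps power2_eq_square power_add)
  finally show ?case by simp
qed

lemma linear_ode_image:
  fixes z u w :: "real \<Rightarrow> real"
  assumes z: "Ck_on n z {s<..<t}" and u: "Ck_on n u {s<..<t}"
    and R: "\<And>x. x \<in> {s<..<t} \<Longrightarrow> deriv z x \<noteq> 0"
    and w: "\<And>x. x \<in> {s<..<t} \<Longrightarrow> w (z x) = u x"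
    and x: "x \<in> {s<..<t}"
  shows "linear_ode n a b w (z x) = a 0 (z x) * u x
    + (\<Sum>k<n. a (Suc k) (z x) * (quot_numer (deriv z) (deriv u) k x / deriv z x ^ (2 * k + 1))) - b (z x)"
proof -
  have "(\<Sum>k<n. a (Suc k) (z x) * (quot_numer (deriv z) (deriv u) k x / deriv z x ^ (2 * k + 1)))
      = (\<Sum>k<n. a (Suc k) (z x) * (deriv ^^ Suc k) w (z x))"
    using image_higher_deriv[OF z u R w _ x] by (intro sum.cong refl) (metis lessThan_iff)
  then show ?thesis
    by (simp add: linear_ode_def sum.atMost_shift w[OF x] del: funpow.simps)
qed

context
  fixes N :: nat and I :: "real set" and R R' S S' :: "real \<Rightarrow> real" and x :: real
  assumes I: "open I" and R: "Ck_on N R I" "Ck_on N R' I" and S: "Ck_on N S I" "Ck_on N S' I" and x: "x \<in> I"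
begin

lemma jet_quot_numer:
  assumes "k + j \<le> N" "jet_eq (k + j) R R' x" "jet_eq (k + j) S S' x"
  shows "jet_eq j (quot_numer R S k) (quot_numer R' S' k) x"
  using assms
proof (induction k arbitrary: j)
  case 0
  then show ?case by simp
next
  case (Suc k)
  note C = Ck_quot_numer[OF I R(1) S(1)] Ck_quot_numer[OF I R(2) S(2)]
  have 0: "jet_eq (Suc j) (quot_numer R S k) (quot_numer R' S' k) x" using Suc by simp
  have "jet_eq j (\<lambda>x. R x * deriv (quot_numer R S k) x) (\<lambda>x. R' x * deriv (quot_numer R' S' k) x) x"
    using Suc.prems 0
    by (intro jet_mult_eq[OF I x] Ck_on_deriv C jet_eq_deriv I) (auto intro: Ck_on_mono R jet_eq_mono)
  moreover have "jet_eq j (\<lambda>x. quot_numer R S k x * deriv R x) (\<lambda>x. quot_numer R' S' k x * deriv R' x) x"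
    using Suc.prems 0
    by (intro jet_mult_eq[OF I x] Ck_on_deriv C jet_eq_deriv I)
      (auto intro: Ck_on_mono[OF R(1)] Ck_on_mono[OF R(2)] jet_eq_mono)
  ultimately show ?case
    using Suc.prems
    by (auto simp: jet_eq_def higher_deriv_quot_numer_Suc[OF I R(1) S(1) _ x] higher_deriv_quot_numer_Suc[OF I R(2) S(2) _ x]
        simp del: quot_numer.simps)
qed

text \<open>The numerators are affine in the top derivatives of \<open>S\<close> and \<open>R\<close>. Only two terms carry
  them: differentiating the numerator \<open>k\<close> times multiplies by \<open>R\<close>, and the derivative of \<open>R\<close> enters
  at top order only in the first step, \<open>R S' - S R'\<close>.\<close>

lemma jet_quot_numer_diff:
  assumes "k + j = Suc m" "Suc m \<le> N" "jet_eq m R R' x" "jet_eq m S S' x"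
  shows "(deriv ^^ j) (quot_numer R' S' k) x - (deriv ^^ j) (quot_numer R S k) x
    = R x ^ k * ((deriv ^^ Suc m) S' x - (deriv ^^ Suc m) S x)
      - (if k = 0 then 0 else R x ^ (k - 1) * S x * ((deriv ^^ Suc m) R' x - (deriv ^^ Suc m) R x))"
  using assms
proof (induction k arbitrary: j)
  case 0
  then show ?case by simp
next
  case (Suc k)
  note C = Ck_quot_numer[OF I R(1) S(1)] Ck_quot_numer[OF I R(2) S(2)]
  have N: "jet_eq j (quot_numer R S k) (quot_numer R' S' k) x"
    using Suc.prems by (intro jet_quot_numer) auto
  have dR: "(deriv ^^ i) (deriv R) x = (deriv ^^ i) (deriv R') x" if "i < m" for i
    using jet_eqD[OF Suc.prems(3), of "Suc i"] that by (simp add: higher_deriv_Suc del: funpow.simps)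
  have 1: "(deriv ^^ j) (\<lambda>x. R' x * deriv (quot_numer R' S' k) x) x - (deriv ^^ j) (\<lambda>x. R x * deriv (quot_numer R S k) x) x
     = R x * ((deriv ^^ j) (deriv (quot_numer R' S' k)) x - (deriv ^^ j) (deriv (quot_numer R S k)) x)"
  proof (rule jet_mult_diff[OF I x])
    show "jet_eq j R R' x" using Suc.prems by (auto intro: jet_eq_mono)
    show "(deriv ^^ i) (deriv (quot_numer R S k)) x = (deriv ^^ i) (deriv (quot_numer R' S' k)) x" if "i < j" for i
      using jet_eqD[OF N, of "Suc i"] that by (simp add: higher_deriv_Suc del: funpow.simps)
  qed (use Suc.prems in \<open>auto intro!: Ck_on_deriv C I intro: Ck_on_mono[OF R(1)] Ck_on_mono[OF R(2)]\<close>)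
  have 2: "(deriv ^^ j) (\<lambda>x. quot_numer R' S' k x * deriv R' x) x - (deriv ^^ j) (\<lambda>x. quot_numer R S k x * deriv R x) x
     = quot_numer R S k x * ((deriv ^^ j) (deriv R') x - (deriv ^^ j) (deriv R) x)"
    by (rule jet_mult_diff[OF I x _ _ _ _ N])
      (use Suc.prems dR in \<open>auto intro!: Ck_on_deriv C I intro: Ck_on_mono[OF R(1)] Ck_on_mono[OF R(2)]\<close>)
  have IH: "(deriv ^^ Suc j) (quot_numer R' S' k) x - (deriv ^^ Suc j) (quot_numer R S k) x
    = R x ^ k * ((deriv ^^ Suc m) S' x - (deriv ^^ Suc m) S x)
      - (if k = 0 then 0 else R x ^ (k - 1) * S x * ((deriv ^^ Suc m) R' x - (deriv ^^ Suc m) R x))"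
    using Suc.prems by (intro Suc.IH) auto
  have "(deriv ^^ j) (quot_numer R' S' (Suc k)) x - (deriv ^^ j) (quot_numer R S (Suc k)) x
     = R x * ((deriv ^^ Suc j) (quot_numer R' S' k) x - (deriv ^^ Suc j) (quot_numer R S k) x)
       - real (2 * k + 1) * (quot_numer R S k x * ((deriv ^^ Suc j) R' x - (deriv ^^ Suc j) R x))"
    unfolding higher_deriv_Suc 1[symmetric] 2[symmetric] using Suc.prems
    by (simp add: higher_deriv_quot_numer_Suc[OF I R(1) S(1) _ x] higher_deriv_quot_numer_Suc[OF I R(2) S(2) _ x]
        algebra_simps del: quot_numer.simps)
  also have "\<dots> = R x ^ Suc k * ((deriv ^^ Suc m) S' x - (deriv ^^ Suc m) S x)
     - R x ^ k * S x * ((deriv ^^ Suc m) R' x - (deriv ^^ Suc m) R x)"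
  proof (cases "k = 0")
    case True
    then have "j = m" using Suc.prems by simp
    with True show ?thesis unfolding IH by (simp add: algebra_simps del: funpow.simps)
  next
    case False
    then have "(deriv ^^ Suc j) R x = (deriv ^^ Suc j) R' x"
      using Suc.prems by (intro jet_eqD[OF Suc.prems(3)]) auto
    with False show ?thesis unfolding IH
      by (cases k) (simp_all add: algebra_simps del: funpow.simps)
  qed
  finally show ?case by simp
qed

end

section \<open>Linear functionals of a jet\<close>

text \<open>\<open>T\<close> is a linear combination of the derivatives of \<open>S\<close> at \<open>x\<close> up to order \<open>m\<close>, with leading
  coefficient \<open>e\<close> and with coefficients that do not depend on \<open>S\<close>. The other coefficients are of no
  interest and stay hidden behind the quantifier. The function \<open>S\<close> may live on any neighbourhood
  \<open>K\<close> of \<open>x\<close> in \<open>X\<close>.\<close>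

definition jet_functional :: "real set \<Rightarrow> real \<Rightarrow> nat \<Rightarrow> nat \<Rightarrow> real \<Rightarrow> ((real \<Rightarrow> real) \<Rightarrow> real) \<Rightarrow> bool" where
  "jet_functional X x N m e T \<longleftrightarrow> (\<exists>d. d m = e \<and>
     (\<forall>K S. open K \<and> x \<in> K \<and> K \<subseteq> X \<and> Ck_on N S K \<longrightarrow> T S = (\<Sum>i\<le>m. d i * (deriv ^^ i) S x)))"

lemma jet_functional_scale:
  assumes "jet_functional X x N m e T"
  shows "jet_functional X x N m (c * e) (\<lambda>S. c * T S)"
proof -
  obtain d where "d m = e" "\<And>K S. open K \<and> x \<in> K \<and> K \<subseteq> X \<and> Ck_on N S K \<Longrightarrow> T S = (\<Sum>i\<le>m. d i * (deriv ^^ i) S x)"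
    using assms unfolding jet_functional_def by blast
  then show ?thesis unfolding jet_functional_def
    by (intro exI[of _ "\<lambda>i. c * d i"]) (auto simp: sum_distrib_left mult.assoc)
qed

lemma jet_functional_add:
  assumes "jet_functional X x N m e T" "jet_functional X x N m e' T'"
  shows "jet_functional X x N m (e + e') (\<lambda>S. T S + T' S)"
proof -
  obtain d where "d m = e" "\<And>K S. open K \<and> x \<in> K \<and> K \<subseteq> X \<and> Ck_on N S K \<Longrightarrow> T S = (\<Sum>i\<le>m. d i * (deriv ^^ i) S x)"
    using assms unfolding jet_functional_def by blast
  moreover obtain d' where "d' m = e'" "\<And>K S. open K \<and> x \<in> K \<and> K \<subseteq> X \<and> Ck_on N S K \<Longrightarrow> T' S = (\<Sum>i\<le>m. d' i * (deriv ^^ i) S x)"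
    using assms unfolding jet_functional_def by blast
  ultimately show ?thesis unfolding jet_functional_def
    by (intro exI[of _ "\<lambda>i. d i + d' i"]) (auto simp: sum.distrib algebra_simps)
qed

lemma jet_functional_raise:
  assumes "jet_functional X x N m e T" "m < m'"
  shows "jet_functional X x N m' 0 T"
proof -
  obtain d where d: "d m = e" "\<And>K S. open K \<and> x \<in> K \<and> K \<subseteq> X \<and> Ck_on N S K \<Longrightarrow> T S = (\<Sum>i\<le>m. d i * (deriv ^^ i) S x)"
    using assms unfolding jet_functional_def by blast
  have "(\<Sum>i\<le>m. d i * (deriv ^^ i) S x) = (\<Sum>i\<le>m'. (if i \<le> m then d i else 0) * (deriv ^^ i) S x)" for S
    using assms(2) by (intro sum.mono_neutral_cong_left) auto
  with d(2) show ?thesis unfolding jet_functional_def using assms(2)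
    by (intro exI[of _ "\<lambda>i. if i \<le> m then d i else 0"]) auto
qed

lemma jet_functional_zero: "jet_functional X x N m 0 (\<lambda>S. 0)"
  unfolding jet_functional_def by (intro exI[of _ "\<lambda>i. 0"]) auto

lemma jet_functional_sum:
  assumes "finite A" "\<And>i. i \<in> A \<Longrightarrow> jet_functional X x N m (e i) (T i)"
  shows "jet_functional X x N m (sum e A) (\<lambda>S. \<Sum>i\<in>A. T i S)"
  using assms
proof (induction A rule: finite_induct)
  case empty
  show ?case by (simp add: jet_functional_zero)
next
  case (insert i A)
  then have "jet_functional X x N m (e i + sum e A) (\<lambda>S. T i S + (\<Sum>i\<in>A. T i S))"
    by (intro jet_functional_add) simp_all
  with insert show ?case by simp
qed

lemma jet_functional_cong:
  assumes "jet_functional X x N m e T"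
    and "\<And>K S. open K \<Longrightarrow> x \<in> K \<Longrightarrow> K \<subseteq> X \<Longrightarrow> Ck_on N S K \<Longrightarrow> T' S = T S"
  shows "jet_functional X x N m e T'"
proof -
  obtain d where d: "d m = e" "\<And>K S. open K \<and> x \<in> K \<and> K \<subseteq> X \<and> Ck_on N S K \<Longrightarrow> T S = (\<Sum>i\<le>m. d i * (deriv ^^ i) S x)"
    using assms(1) unfolding jet_functional_def by blast
  show ?thesis unfolding jet_functional_def
  proof (intro exI[of _ d] conjI allI impI d(1))
    fix K S assume "open K \<and> x \<in> K \<and> K \<subseteq> X \<and> Ck_on N S K"
    then show "T' S = (\<Sum>i\<le>m. d i * (deriv ^^ i) S x)"
      using d(2)[of K S] assms(2)[of K S] by simp
  qed
qed

text \<open>For a fixed change of the independent variable the numerators are linear in \<open>S\<close>.\<close>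

lemma jet_functional_quot_numer:
  assumes X: "open X" and r: "Ck_on N r X"
  shows "k + j \<le> N \<Longrightarrow> jet_functional X x N (k + j) (r x ^ k) (\<lambda>S. (deriv ^^ j) (quot_numer r S k) x)"
proof (induction k arbitrary: j)
  case 0
  show ?case unfolding jet_functional_def
    by (intro exI[of _ "\<lambda>i. if i = j then 1 else 0"]) (simp add: if_distrib[of "\<lambda>c. c * _"] cong: if_cong)
next
  case (Suc k)
  let ?D = "\<lambda>j S. (deriv ^^ j) (quot_numer r S k) x"
  let ?m = "Suc k + j"
  let ?A = "\<lambda>i S. real (j choose i) * (deriv ^^ i) r x * ?D (Suc (j - i)) S"
  let ?B = "\<lambda>i S. - real (2 * k + 1) * real (j choose i) * (deriv ^^ Suc (j - i)) r x * ?D i S"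
  have "jet_functional X x N ?m (if i = 0 then r x ^ Suc k else 0) (?A i)" if "i \<le> j" for i
  proof (cases "i = 0")
    case True
    then show ?thesis using jet_functional_scale[OF Suc.IH[of "Suc j"], of "r x"] Suc.prems by simp
  next
    case False
    have "jet_functional X x N ?m 0 (?D (Suc (j - i)))"
      using Suc.prems False that by (intro jet_functional_raise[OF Suc.IH[of "Suc (j - i)"]]) auto
    from jet_functional_scale[OF this, of "real (j choose i) * (deriv ^^ i) r x"] False show ?thesis
      unfolding mult_zero_right by (simp only: if_False)
  qed
  then have A: "jet_functional X x N ?m (\<Sum>i\<le>j. if i = 0 then r x ^ Suc k else 0) (\<lambda>S. \<Sum>i\<le>j. ?A i S)"
    by (intro jet_functional_sum) auto
  have "jet_functional X x N ?m 0 (?B i)" if "i \<le> j" for i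
  proof -
    have "jet_functional X x N ?m 0 (?D i)"
      using Suc.prems that by (intro jet_functional_raise[OF Suc.IH[of i]]) auto
    from jet_functional_scale[OF this, of "- real (2 * k + 1) * real (j choose i) * (deriv ^^ Suc (j - i)) r x"]
    show ?thesis unfolding mult_zero_right .
  qed
  then have B: "jet_functional X x N ?m (\<Sum>i\<le>j. 0) (\<lambda>S. \<Sum>i\<le>j. ?B i S)"
    by (intro jet_functional_sum) auto
  have "jet_functional X x N ?m (r x ^ Suc k) (\<lambda>S. (\<Sum>i\<le>j. ?A i S) + (\<Sum>i\<le>j. ?B i S))"
    using jet_functional_add[OF A B] by simp
  then show ?case
  proof (rule jet_functional_cong)
    fix K S assume K: "open K" "x \<in> K" "K \<subseteq> X" and S: "Ck_on N S K"
    have rK: "Ck_on N r K" using r K by (auto intro: Ck_on_subset)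
    note C = Ck_quot_numer[OF K(1) rK S]
    have 1: "(deriv ^^ j) (\<lambda>x. r x * deriv (quot_numer r S k) x) x = (\<Sum>i\<le>j. ?A i S)"
      using Suc.prems
      by (subst higher_deriv_mult[OF K(1) _ _ K(2)])
        (auto intro!: Ck_on_deriv K C intro: Ck_on_mono[OF rK] simp: higher_deriv_Suc simp del: funpow.simps)
    have 2: "(deriv ^^ j) (\<lambda>x. quot_numer r S k x * deriv r x) x
       = (\<Sum>i\<le>j. real (j choose i) * (deriv ^^ i) (quot_numer r S k) x * (deriv ^^ Suc (j - i)) r x)"
      using Suc.prems
      by (subst higher_deriv_mult[OF K(1) _ _ K(2)])
        (auto intro!: Ck_on_deriv K C intro: Ck_on_mono[OF rK] simp: higher_deriv_Suc simp del: funpow.simps)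
    show "(deriv ^^ j) (quot_numer r S (Suc k)) x = (\<Sum>i\<le>j. ?A i S) + (\<Sum>i\<le>j. ?B i S)"
      unfolding higher_deriv_quot_numer_Suc[OF K(1) rK S Suc.prems K(2)] 1 2
      by (simp add: sum_distrib_left sum_negf algebra_simps del: funpow.simps of_nat_Suc)
  qed
qed

text \<open>Hence the left-hand side of a linear equation in the new variable is, up to the term of
  order zero, a linear differential expression in the old one.\<close>

lemma jet_functional_image:
  assumes X: "open X" and r: "Ck_on N r X"
  shows "jet_functional X x N N (a (Suc N) * r x ^ N / r x ^ (2 * N + 1))
    (\<lambda>S. \<Sum>k<Suc N. a (Suc k) * (quot_numer r S k x / r x ^ (2 * k + 1)))"
proof -
  have "jet_functional X x N N (if k = N then a (Suc N) * r x ^ N / r x ^ (2 * N + 1) else 0)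
      (\<lambda>S. a (Suc k) * (quot_numer r S k x / r x ^ (2 * k + 1)))" if "k < Suc N" for k
  proof (cases "k = N")
    case True
    then show ?thesis
      using jet_functional_scale[OF jet_functional_quot_numer[OF X r, of k 0 x], of "a (Suc k) / r x ^ (2 * k + 1)"] by simp
  next
    case False
    have "jet_functional X x N N 0 (\<lambda>S. quot_numer r S k x)"
      using jet_functional_quot_numer[OF X r, of k 0 x] False that
      by (intro jet_functional_raise[of X x N k "r x ^ k"]) auto
    from jet_functional_scale[OF this, of "a (Suc k) / r x ^ (2 * k + 1)"] False show ?thesis by simp
  qed
  then have "jet_functional X x N N (\<Sum>k<Suc N. if k = N then a (Suc N) * r x ^ N / r x ^ (2 * N + 1) else 0)
    (\<lambda>S. \<Sum>k<Suc N. a (Suc k) * (quot_numer r S k x / r x ^ (2 * k + 1)))"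
    by (intro jet_functional_sum) auto
  then show ?thesis by simp
qed

section \<open>The iterated operator along straight lines\<close>

text \<open>The coefficient comparison behind both recursions, \<open>line_coeff\<close> with \<open>z\<^sub>j = s\<^sup>j\<close> and
  \<open>lin_coeff\<close> with \<open>z\<^sub>j = y\<^sup>(\<^sup>j\<^sup>)\<close>.\<close>

lemma sum_shift_index:
  fixes A B z :: "nat \<Rightarrow> real"
  assumes "A (Suc k) = 0"
  shows "(\<Sum>j\<le>k. A j * z j) + (\<Sum>j\<le>k. B j * z (Suc j))
    = (\<Sum>j\<le>Suc k. (A j + (if j = 0 then 0 else B (j - 1))) * z j)"
proof -
  have "(\<Sum>j\<le>Suc k. (if j = 0 then 0 else B (j - 1)) * z j) = (\<Sum>j\<le>k. B j * z (Suc j))"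
    by (subst sum.atMost_Suc_shift) simp
  then show ?thesis using assms by (simp only: distrib_right sum.distrib) simp
qed

text \<open>Along a line of slope \<open>s\<close> the total derivative is \<open>\<partial>\<^sub>x + s \<partial>\<^sub>y\<close>, so \<open>\<Omega>\<^sup>k[y]\<close> is a polynomial in
  \<open>s\<close>; its coefficients are functions on the plane and satisfy this recursion.\<close>

primrec line_coeff :: "(real \<times> real \<Rightarrow> real) \<Rightarrow> nat \<Rightarrow> nat \<Rightarrow> real \<times> real \<Rightarrow> real" where
  "line_coeff F 0 = (\<lambda>j. if j = 0 then snd else (\<lambda>p. 0))"
| "line_coeff F (Suc k) = (\<lambda>j p. pd_x (line_coeff F k j) p
     + (if j = 0 then 0 else pd_y (line_coeff F k (j - 1)) p) + F p * line_coeff F k j p)"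

lemma line_coeff_zero: "k < j \<Longrightarrow> line_coeff F k j = (\<lambda>p. 0)"
proof (induction k arbitrary: j)
  case (Suc k)
  then have 0: "line_coeff F k j = (\<lambda>p. 0)" "line_coeff F k (j - 1) = (\<lambda>p. 0)" by auto
  show ?case using Suc.prems 0 by (intro ext) simp
qed simp

text \<open>The coefficient of \<open>s\<close> in \<open>\<Omega>[y] = s + F y\<close> is constant, so no term of full degree survives
  the next step.\<close>

lemma line_coeff_diag: "line_coeff F (Suc (Suc k)) (Suc (Suc k)) = (\<lambda>p. 0)"
proof (induction k)
  case 0
  have "line_coeff F (Suc 0) (Suc 0) = (\<lambda>p. 1)" by (simp add: fun_eq_iff)
  then show ?case by (simp only: line_coeff.simps(2)[of F "Suc 0"]) (simp add: line_coeff_zero fun_eq_iff)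
next
  case (Suc k)
  then show ?case
    by (simp only: line_coeff.simps(2)[of F "Suc (Suc k)"]) (simp add: line_coeff_zero del: line_coeff.simps)
qed

text \<open>Consequently the term of degree \<open>k - 1\<close> in \<open>\<Omega>\<^sup>k[y]\<close> comes from \<open>\<partial>\<^sub>y\<close> alone, starting with
  the coefficient \<open>(y F)\<^sub>y + F\<close> of \<open>s\<close> in \<open>\<Omega>\<^sup>2[y]\<close>.\<close>

lemma line_coeff_subdiag:
  "line_coeff F (Suc (Suc k)) (Suc k) = (pd_y ^^ k) (\<lambda>p. pd_y (\<lambda>p. F p * snd p) p + F p)"
proof (induction k)
  case 0
  have "line_coeff F (Suc 0) (Suc 0) = (\<lambda>p. 1)" "line_coeff F (Suc 0) 0 = (\<lambda>p. F p * snd p)"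
    by (simp_all add: fun_eq_iff)
  then show ?case by (simp only: line_coeff.simps(2)[of F "Suc 0"]) simp
next
  case (Suc k)
  have "line_coeff F (Suc (Suc (Suc k))) (Suc (Suc k)) = (\<lambda>p. pd_y (line_coeff F (Suc (Suc k)) (Suc k)) p)"
    by (simp only: line_coeff.simps(2)[of F "Suc (Suc k)"] line_coeff_diag) simp
  then show ?case by (simp only: Suc.IH funpow.simps o_apply)
qed

lemma Ck_line_coeff:
  assumes "open V" "Ck_on n F V" "k + i \<le> n"
  shows "Ck_on i (line_coeff F k j) V"
  using assms(3)
proof (induction k arbitrary: i j)
  case 0
  then show ?case by (auto intro: Ck_on_bounded_linear bounded_linear_snd)
next
  case (Suc k)
  then have "Ck_on (Suc i) (line_coeff F k j) V" "Ck_on i (line_coeff F k j) V" for j by auto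
  then show ?case using Suc.prems assms(1)
    by (cases "j = 0") (auto intro!: Ck_on_add Ck_on_mult Ck_pd intro: Ck_on_mono[OF assms(2)])
qed

lemma Om_line:
  assumes y: "smooth_curve n V I (\<lambda>t. y0 + s * (t - x0))" and F: "Ck_on n F V"
    and "k \<le> n" "x \<in> I"
  shows "Om F (\<lambda>t. y0 + s * (t - x0)) k x = (\<Sum>j\<le>k. line_coeff F k j (x, y0 + s * (x - x0)) * s ^ j)"
  using assms(3,4)
proof (induction k arbitrary: x)
  case 0
  then show ?case by simp
next
  case (Suc k)
  let ?y = "\<lambda>t. y0 + s * (t - x0)"
  note D = smooth_curveD[OF y]
  have d: "(along (line_coeff F k j) ?y has_real_derivative
     pd_x (line_coeff F k j) (x, ?y x) + pd_y (line_coeff F k j) (x, ?y x) * s) (at x)" for j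
    unfolding along_def
  proof (rule DERIV_along)
    show "line_coeff F k j differentiable at (x, ?y x)"
      using Suc.prems D by (intro Ck_on_differentiable[OF D(1) Ck_line_coeff[OF D(1) F, of k "Suc 0"]]) auto
  qed (auto intro!: derivative_eq_intros)
  have "\<forall>\<^sub>F t in nhds x. Om F ?y k t = (\<Sum>j\<le>k. along (line_coeff F k j) ?y t * s ^ j)"
    using Suc D(2) by (auto simp: eventually_nhds along_def)
  then have "deriv (Om F ?y k) x = deriv (\<lambda>t. \<Sum>j\<le>k. along (line_coeff F k j) ?y t * s ^ j) x"
    by (intro deriv_cong_ev) auto
  also have "\<dots> = (\<Sum>j\<le>k. (pd_x (line_coeff F k j) (x, ?y x) + pd_y (line_coeff F k j) (x, ?y x) * s) * s ^ j)"
    by (intro DERIV_imp_deriv DERIV_sum DERIV_cmult_right d)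
  finally have "Om F ?y (Suc k) x =
      (\<Sum>j\<le>k. (pd_x (line_coeff F k j) (x, ?y x) + F (x, ?y x) * line_coeff F k j (x, ?y x)) * s ^ j)
      + (\<Sum>j\<le>k. pd_y (line_coeff F k j) (x, ?y x) * s ^ Suc j)"
    using Suc by (simp add: Om_Suc along_def sum_distrib_left sum.distrib algebra_simps)
  also have "\<dots> = (\<Sum>j\<le>Suc k. line_coeff F (Suc k) j (x, ?y x) * s ^ j)"
    by (subst sum_shift_index) (auto simp: line_coeff_zero intro!: sum.cong)
  finally show ?case .
qed

lemma higher_deriv_slice: "(pd_y ^^ k) f (x, t) = (deriv ^^ k) (\<lambda>t. f (x, t)) t"
proof (induction k arbitrary: t)
  case (Suc k)
  then have "(\<lambda>t. (pd_y ^^ k) f (x, t)) = (deriv ^^ k) (\<lambda>t. f (x, t))" by (intro ext)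
  then show ?case by (simp add: pd_y_def[of "(pd_y ^^ k) f"])
qed simp

text \<open>The expression \<open>c \<phi> + t \<phi>'\<close> is reproduced by differentiation with \<open>c\<close> raised by one.\<close>

lemma higher_deriv_euler:
  fixes \<phi> :: "real \<Rightarrow> real"
  assumes Y: "open Y" and \<phi>: "Ck_on (Suc k) \<phi> Y" and "t \<in> Y"
  shows "(deriv ^^ k) (\<lambda>t. c * \<phi> t + t * deriv \<phi> t) t = (c + real k) * (deriv ^^ k) \<phi> t + t * (deriv ^^ Suc k) \<phi> t"
  using \<phi> \<open>t \<in> Y\<close>
proof (induction k arbitrary: t)
  case (Suc k)
  have \<phi>k: "Ck_on (Suc k) \<phi> Y" using Suc.prems by (auto intro: Ck_on_mono)
  have d: "((deriv ^^ k) \<phi> has_real_derivative (deriv ^^ Suc k) \<phi> t) (at t)"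
    "((deriv ^^ Suc k) \<phi> has_real_derivative (deriv ^^ Suc (Suc k)) \<phi> t) (at t)"
    using Suc.prems Ck_on_DERIV[OF Y Ck_on_higher_deriv[OF Y, of k 2 \<phi>], of t]
      Ck_on_DERIV[OF Y Ck_on_higher_deriv[OF Y, of "Suc k" 1 \<phi>], of t] by simp_all
  have "\<forall>\<^sub>F t in nhds t. (deriv ^^ k) (\<lambda>t. c * \<phi> t + t * deriv \<phi> t) t = (c + real k) * (deriv ^^ k) \<phi> t + t * (deriv ^^ Suc k) \<phi> t"
    using Suc.IH[OF \<phi>k] Suc.prems Y by (auto simp: eventually_nhds)
  then have "(deriv ^^ Suc k) (\<lambda>t. c * \<phi> t + t * deriv \<phi> t) t = deriv (\<lambda>t. (c + real k) * (deriv ^^ k) \<phi> t + t * (deriv ^^ Suc k) \<phi> t) t"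
    by (simp only: funpow.simps o_apply) (intro deriv_cong_ev, auto)
  also have "\<dots> = (c + real k) * (deriv ^^ Suc k) \<phi> t + (1 * (deriv ^^ Suc k) \<phi> t + (deriv ^^ Suc (Suc k)) \<phi> t * t)"
    by (intro DERIV_imp_deriv DERIV_add DERIV_cmult DERIV_mult DERIV_ident d)
  finally show ?case by (simp add: algebra_simps del: funpow.simps)
qed simp

text \<open>Both hypotheses come from comparing coefficients of the equation with those of a linear one.
  After \<open>m\<close> differentiations their difference is \<open>m \<phi>\<^sup>(\<^sup>m\<^sup>)\<close>, so \<open>\<phi>\<^sup>(\<^sup>m\<^sup>) = 0\<close>; and the first one gives
  \<open>(m + 2 + j) \<phi>\<^sup>(\<^sup>j\<^sup>) + t \<phi>\<^sup>(\<^sup>j\<^sup>+\<^sup>1\<^sup>) = 0\<close> for \<open>j \<ge> 1\<close>, along which the vanishing descends to \<open>\<phi>'\<close>.\<close>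

lemma euler_rigidity:
  fixes \<phi> :: "real \<Rightarrow> real"
  assumes Y: "open Y" and \<phi>: "Ck_on (Suc (Suc m)) \<phi> Y" and m: "m \<ge> 1"
    and 1: "\<And>t. t \<in> Y \<Longrightarrow> deriv (\<lambda>t. real (Suc (Suc m)) * \<phi> t + t * deriv \<phi> t) t = 0"
    and 2: "\<And>t. t \<in> Y \<Longrightarrow> (deriv ^^ m) (\<lambda>t. 2 * \<phi> t + t * deriv \<phi> t) t = 0"
    and t: "t \<in> Y"
  shows "deriv \<phi> t = 0"
proof -
  have \<phi>j: "Ck_on (Suc j) \<phi> Y" if "j \<le> m" for j using \<phi> that by (auto intro: Ck_on_mono)
  have E: "(real (Suc (Suc m)) + real j) * (deriv ^^ j) \<phi> t + t * (deriv ^^ Suc j) \<phi> t = 0"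
    if "1 \<le> j" "j \<le> m" "t \<in> Y" for j t
  proof -
    obtain i where i: "j = Suc i" using \<open>1 \<le> j\<close> by (cases j) auto
    have "(deriv ^^ j) (\<lambda>t. real (Suc (Suc m)) * \<phi> t + t * deriv \<phi> t) t = (deriv ^^ i) (\<lambda>t. 0) t"
      unfolding i higher_deriv_Suc by (rule higher_deriv_cong[OF Y 1 that(3)])
    then show ?thesis
      using higher_deriv_euler[OF Y \<phi>j[OF that(2)] that(3)] by (simp add: higher_deriv_zero del: funpow.simps of_nat_Suc)
  qed
  have top: "(deriv ^^ m) \<phi> t = 0" if "t \<in> Y" for t
  proof -
    have "(2 + real m) * (deriv ^^ m) \<phi> t + t * (deriv ^^ Suc m) \<phi> t = 0"
      using higher_deriv_euler[OF Y \<phi>j[OF order_refl] that, of 2] 2[OF that] by simp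
    moreover have "real m * (deriv ^^ m) \<phi> t
      = ((real (Suc (Suc m)) + real m) * (deriv ^^ m) \<phi> t + t * (deriv ^^ Suc m) \<phi> t)
        - ((2 + real m) * (deriv ^^ m) \<phi> t + t * (deriv ^^ Suc m) \<phi> t)"
      by (simp add: algebra_simps del: funpow.simps)
    ultimately have "real m * (deriv ^^ m) \<phi> t = 0" using E[OF m order_refl that] by linarith
    with m show ?thesis by simp
  qed
  have "\<forall>t\<in>Y. (deriv ^^ (m - i)) \<phi> t = 0" if "i < m" for i
    using that
  proof (induction i)
    case 0
    then show ?case using top by simp
  next
    case (Suc i)
    show ?case
    proof
      fix t assume t: "t \<in> Y"
      have "m - i = Suc (m - Suc i)" using Suc.prems by simp
      then have "(deriv ^^ Suc (m - Suc i)) \<phi> t = 0" using Suc t by (metis Suc_lessD)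
      with E[of "m - Suc i" t] Suc.prems t show "(deriv ^^ (m - Suc i)) \<phi> t = 0"
        by (simp del: funpow.simps)
    qed
  qed
  from this[of "m - 1"] m t show ?thesis by simp
qed

section \<open>The key identity for a linearizing transformation\<close>

definition jac :: "(real \<times> real \<Rightarrow> real) \<Rightarrow> (real \<times> real \<Rightarrow> real) \<Rightarrow> real \<times> real \<Rightarrow> real" where
  "jac \<rho> \<psi> p = pd_x \<rho> p * pd_y \<psi> p - pd_y \<rho> p * pd_x \<psi> p"

text \<open>The data of a linearization near a point, with the differentiability order reduced to what
  an equation of order \<open>n\<close> involves.\<close>

locale linearization =
  fixes n :: nat and V :: "(real \<times> real) set" and F \<rho> \<psi> :: "real \<times> real \<Rightarrow> real"
    and a :: "nat \<Rightarrow> real \<Rightarrow> real" and b :: "real \<Rightarrow> real"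
  assumes n: "3 \<le> n" and V: "open V"
    and F: "Ck_on n F V" and \<rho>: "Ck_on n \<rho> V" and \<psi>: "Ck_on n \<psi> V"
    and jac: "\<And>p. p \<in> V \<Longrightarrow> jac \<rho> \<psi> p \<noteq> 0"
    and coeffs: "linear_coeffs_on n a b (\<rho> ` V)"
    and maps: "maps_ode n V \<rho> \<psi> (Omega_iter F n) (linear_ode n a b)"
begin

text \<open>\<open>R y\<close> and \<open>S y\<close> are the total derivatives of the new variables, and \<open>L y\<close> is the left-hand side
  of the linear equation at the image of the curve, written in the old independent variable.\<close>

abbreviation "R y \<equiv> deriv (along \<rho> y)"

abbreviation "S y \<equiv> deriv (along \<psi> y)"

abbreviation "L y x \<equiv> a 0 (\<rho> (x, y x)) * \<psi> (x, y x)
    + (\<Sum>k<n. a (Suc k) (\<rho> (x, y x)) * (quot_numer (R y) (S y) k x / R y x ^ (2 * k + 1))) - b (\<rho> (x, y x))"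

lemma n_ge_3E: obtains m where "n = Suc (Suc m)" "m \<ge> 1"
proof (rule that)
  show "n = Suc (Suc (n - 2))" "n - 2 \<ge> 1" using n by auto
qed

lemma coeff_n_nonzero: "p \<in> V \<Longrightarrow> a n (\<rho> p) \<noteq> 0"
  using coeffs by (auto simp: linear_coeffs_on_def)

lemma Ck_R_S:
  assumes "smooth_curve n V I y" "Suc k \<le> n"
  shows "Ck_on k (R y) I" "Ck_on k (S y) I"
  using smooth_curveD[OF assms(1)] assms(2)
  by (auto intro!: Ck_on_deriv Ck_along[OF assms(1)] intro: Ck_on_mono[OF \<rho>] Ck_on_mono[OF \<psi>])

text \<open>The hypothesis on the transformation, freed from the auxiliary function \<open>w\<close>.\<close>

lemma image_solution:
  assumes y: "smooth_curve n V I y" and x: "x \<in> I" and R: "R y x \<noteq> 0"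
    and E: "Om F y n x = 0"
  shows "L y x = 0"
proof -
  note D = smooth_curveD[OF y]
  have "continuous_on I (R y)"
    using Ck_R_S[OF y, of 0] n by (simp add: Ck_on.simps)
  then have "open (I \<inter> R y -` (- {0}))"
    using D(2) by (intro continuous_open_preimage) auto
  moreover have "x \<in> I \<inter> R y -` (- {0})" using x R by simp
  ultimately obtain e where e: "e > 0" "{x - e<..<x + e} \<subseteq> I \<inter> R y -` (- {0})"
    by (rule open_real_interval)
  let ?K = "{x - e<..<x + e}"
  have K: "smooth_curve n V ?K y" by (rule smooth_curve_subset[OF y]) (use e in auto)
  have z: "Ck_on n (along \<rho> y) ?K" "Ck_on n (along \<psi> y) ?K"
    by (auto intro: Ck_along[OF K] \<rho> \<psi>)
  have Rnz: "R y t \<noteq> 0" if "t \<in> ?K" for t using e that by auto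
  have "\<exists>w. \<forall>t\<in>?K. w (along \<rho> y t) = along \<psi> y t"
    using Rnz Ck_on_DERIV[OF _ z(1)] n by (intro image_exists) auto
  then obtain w where w: "\<And>t. t \<in> ?K \<Longrightarrow> w (along \<rho> y t) = along \<psi> y t" by blast
  have "curve_in n V ?K y"
    unfolding curve_in_def C_class_def using smooth_curveD[OF K] by (auto intro: Ck_on_mono)
  moreover have "transforms_to \<rho> \<psi> ?K y w"
    unfolding transforms_to_def using Rnz w by (auto simp: along_def)
  ultimately have "linear_ode n a b w (\<rho> (x, y x)) = 0"
    using maps E e(1) unfolding maps_ode_def by (metis add_strict_increasing2 diff_gt_0_iff_gt diff_less_eq greaterThanLessThan_iff less_add_same_cancel1 order_refl)
  then show ?thesis
    using linear_ode_image[OF z Rnz w, of x a b] e(1) by (simp add: along_def)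
qed

text \<open>Both sides are affine in \<open>y\<^sup>(\<^sup>n\<^sup>)\<close> for fixed lower derivatives, they have the same slope
  \<open>a\<^sub>n J / R\<^sup>n\<^sup>+\<^sup>1\<close>, and by \<open>image_solution\<close> they vanish together. To compare them, the curve is
  perturbed at \<open>x\<close> in order \<open>n\<close> so that it satisfies the equation at that point.\<close>

lemma key_identity:
  assumes y: "smooth_curve n V I y" and x: "x \<in> I" and R: "R y x \<noteq> 0"
  shows "L y x = a n (\<rho> (x, y x)) * jac \<rho> \<psi> (x, y x) / R y x ^ (n + 1) * Om F y n x"
proof -
  \<comment> \<open>Chosen so that the perturbed curve satisfies the equation at \<open>x\<close>.\<close>
  define c where "c = - Om F y n x"
  define y' where "y' = (\<lambda>t. y t + c / fact n * (t - x) ^ n)"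
  obtain m where m: "n = Suc (Suc m)" by (rule n_ge_3E)
  obtain K where K: "x \<in> K" "K \<subseteq> I" and yK: "smooth_curve n V K y" "smooth_curve n V K y'"
    using smooth_curve_perturb[OF y x, of n c] n unfolding y'_def by auto
  note D = smooth_curveD[OF yK(1)]
  have dy: "(deriv ^^ j) y' x = (deriv ^^ j) y x + (if j = n then c else 0)" if "j \<le> n" for j
    unfolding y'_def using that by (intro higher_deriv_perturb[OF D(2,3) K(1)]) auto
  have J: "jet_eq (Suc m) y y' x"
    using dy by (auto simp: jet_eq_def m)
  have yx: "y' x = y x" using jet_eq_value[OF J] by simp
  have "Om F y' n x - Om F y n x = c"
    using jet_Om_diff[OF yK F K(1), of n 0 "Suc m"] J dy[of n] by (simp add: m del: funpow.simps)
  then have E: "Om F y' n x = 0" by (simp add: c_def)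
  have J\<rho>: "jet_eq (Suc m) (along \<rho> y) (along \<rho> y') x" and J\<psi>: "jet_eq (Suc m) (along \<psi> y) (along \<psi> y') x"
    using m by (auto intro!: jet_along_eq[OF yK _ K(1) J] intro: Ck_on_mono[OF \<rho>] Ck_on_mono[OF \<psi>])
  have JR: "jet_eq m (R y) (R y') x" and JS: "jet_eq m (S y) (S y') x"
    by (rule jet_eq_deriv J\<rho> J\<psi>)+
  have Rx: "R y' x = R y x" using jet_eq_value[OF JR] by simp
  have d: "(deriv ^^ Suc m) (R y') x - (deriv ^^ Suc m) (R y) x = pd_y \<rho> (x, y x) * c"
     "(deriv ^^ Suc m) (S y') x - (deriv ^^ Suc m) (S y) x = pd_y \<psi> (x, y x) * c"
    using jet_along_diff[OF yK[unfolded m] \<rho>[unfolded m] K(1) J] jet_along_diff[OF yK[unfolded m] \<psi>[unfolded m] K(1) J]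
      dy[of n] by (simp_all add: m higher_deriv_Suc del: funpow.simps)
  have CR: "Ck_on (Suc m) (R y) K" "Ck_on (Suc m) (R y') K" "Ck_on (Suc m) (S y) K" "Ck_on (Suc m) (S y') K"
    using m by (auto intro!: Ck_R_S[OF yK(1)] Ck_R_S[OF yK(2)])
  have num_eq: "quot_numer (R y') (S y') k x = quot_numer (R y) (S y) k x" if "k \<le> m" for k
    using jet_eq_value[OF jet_quot_numer[OF D(2) CR K(1), of k 0]] that
    by (simp add: jet_eq_mono[OF JR] jet_eq_mono[OF JS])
  have num_diff: "quot_numer (R y') (S y') (Suc m) x - quot_numer (R y) (S y) (Suc m) x
     = R y x ^ m * (R y x * pd_y \<psi> (x, y x) - S y x * pd_y \<rho> (x, y x)) * c"
    using jet_quot_numer_diff[OF D(2) CR K(1), of "Suc m" 0 m] JR JS unfolding d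
    by (simp add: algebra_simps del: quot_numer.simps)
  have "R y x * pd_y \<psi> (x, y x) - S y x * pd_y \<rho> (x, y x) = jac \<rho> \<psi> (x, y x)"
    unfolding deriv_along[OF yK(1)[unfolded m] \<rho>[unfolded m] K(1)] deriv_along[OF yK(1)[unfolded m] \<psi>[unfolded m] K(1)]
    by (simp add: along_def jac_def algebra_simps)
  with num_diff have num_diff: "quot_numer (R y') (S y') (Suc m) x
      = quot_numer (R y) (S y) (Suc m) x + R y x ^ m * jac \<rho> \<psi> (x, y x) * c"
    by (simp del: quot_numer.simps)
  have "L y' x = 0" using image_solution[OF yK(2) K(1) _ E] R Rx by simp
  moreover have "L y' x = L y x + a n (\<rho> (x, y x)) * (R y x ^ m * jac \<rho> \<psi> (x, y x) * c / R y x ^ (2 * Suc m + 1))"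
    unfolding m by (simp add: yx Rx num_eq num_diff add_divide_distrib algebra_simps del: quot_numer.simps)
  ultimately have "L y x = - (a n (\<rho> (x, y x)) * (R y x ^ m * jac \<rho> \<psi> (x, y x) * c / R y x ^ (2 * Suc m + 1)))"
    by simp
  also have "\<dots> = a n (\<rho> (x, y x)) * jac \<rho> \<psi> (x, y x) / R y x ^ (n + 1) * Om F y n x"
  proof -
    have "R y x ^ (2 * Suc m + 1) = R y x ^ m * R y x ^ (n + 1)"
      by (simp add: m power_add[symmetric] mult_2)
    then show ?thesis using R by (simp add: c_def field_simps)
  qed
  finally show ?thesis .
qed

section \<open>The new independent variable does not depend on \<open>y\<close>\<close>

lemma R_S_eq:
  assumes "smooth_curve n V I y" "x \<in> I"
  shows "R y x = pd_x \<rho> (x, y x) + pd_y \<rho> (x, y x) * deriv y x"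
    and "S y x = pd_x \<psi> (x, y x) + pd_y \<psi> (x, y x) * deriv y x"
proof -
  obtain m where m: "n = Suc m" using n by (cases n) auto
  show "R y x = pd_x \<rho> (x, y x) + pd_y \<rho> (x, y x) * deriv y x"
    "S y x = pd_x \<psi> (x, y x) + pd_y \<psi> (x, y x) * deriv y x"
    using deriv_along[OF assms(1)[unfolded m] \<rho>[unfolded m] assms(2)]
      deriv_along[OF assms(1)[unfolded m] \<psi>[unfolded m] assms(2)] by (simp_all add: along_def)
qed

text \<open>If \<open>\<rho>\<^sub>y \<noteq> 0\<close>, the slope \<open>- \<rho>\<^sub>x / \<rho>\<^sub>y\<close> is the one for which the image of the curve becomes
  vertical. The Jacobian then forces \<open>S \<noteq> 0\<close>, and a second order perturbation makes the zero of
  \<open>R\<close> simple.\<close>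

lemma critical_curve:
  assumes q: "(x0, y0) \<in> V" and \<rho>y: "pd_y \<rho> (x0, y0) \<noteq> 0"
  obtains I y where "x0 \<in> I" "smooth_curve n V I y" "R y x0 = 0" "deriv (R y) x0 \<noteq> 0" "S y x0 \<noteq> 0"
proof -
  define s where "s = - pd_x \<rho> (x0, y0) / pd_y \<rho> (x0, y0)"
  define y where "y = (\<lambda>t. y0 + s * (t - x0))"
  \<comment> \<open>Adding \<open>(t - x\<^sub>0)\<^sup>2 / 2\<close> changes \<open>R'\<close> by \<open>\<rho>\<^sub>y \<noteq> 0\<close>, so \<open>R'\<close> is nonzero for one of the two curves.\<close>
  define y' where "y' = (\<lambda>t. y t + 1 / fact 2 * (t - x0) ^ 2)"
  obtain I where I: "x0 \<in> I" "smooth_curve n V I y"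
    using curve_with_slope[OF V q] unfolding y_def by blast
  obtain K where K: "x0 \<in> K" "smooth_curve n V K y" "smooth_curve n V K y'"
    using smooth_curve_perturb[OF I(2,1), of 2 1] unfolding y'_def by auto
  note D = smooth_curveD[OF K(2)]
  have dy: "(deriv ^^ j) y' x0 = (deriv ^^ j) y x0 + (if j = 2 then 1 else 0)" if "j \<le> 2" for j
    unfolding y'_def using that n by (intro higher_deriv_perturb[OF D(2,3) K(1)]) auto
  have y0: "y x0 = y0" "deriv y x0 = s" by (simp_all add: y_def deriv_line)
  have y0': "y' x0 = y0" "deriv y' x0 = s" using dy[of 0] dy[of 1] y0 by auto
  have J: "jet_eq 1 y y' x0" using dy by (auto simp: jet_eq_def)
  have 2: "smooth_curve (Suc 1) V K y" "smooth_curve (Suc 1) V K y'" "Ck_on (Suc 1) \<rho> V"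
    using n by (auto intro: smooth_curve_mono[OF K(2)] smooth_curve_mono[OF K(3)] Ck_on_mono[OF \<rho>])
  have R': "deriv (R y') x0 - deriv (R y) x0 = pd_y \<rho> (x0, y0)"
    using jet_along_diff[OF 2 K(1) J] dy[of 2] by (simp add: y0 numeral_2_eq_2)
  have R: "R y x0 = 0" "R y' x0 = 0"
    using \<rho>y by (simp_all add: R_S_eq[OF K(2,1)] R_S_eq[OF K(3,1)] y0 y0' s_def)
  have "pd_y \<rho> (x0, y0) * (pd_x \<psi> (x0, y0) + pd_y \<psi> (x0, y0) * s) = - jac \<rho> \<psi> (x0, y0)"
    using \<rho>y by (simp add: s_def jac_def field_simps)
  then have S: "S y x0 \<noteq> 0" "S y' x0 \<noteq> 0"
    using jac[OF q] by (auto simp add: R_S_eq[OF K(2,1)] R_S_eq[OF K(3,1)] y0 y0')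
  show thesis
  proof (cases "deriv (R y) x0 = 0")
    case True
    then show thesis using that[OF K(1,3)] R R' S \<rho>y by simp
  next
    case False
    then show thesis using that[OF K(1,2)] R S by simp
  qed
qed

lemma continuous_along:
  assumes "smooth_curve n V I y" "continuous_on V f"
  shows "continuous_on I (\<lambda>t. f (t, y t))"
  using smooth_curveD[OF assms(1)] assms(2)
  by (auto intro!: continuous_on_compose2[of V f] continuous_intros Ck_on_imp_continuous_on[of n])

lemma continuous_coeff:
  assumes "smooth_curve n V I y" "continuous_on (\<rho> ` V) c"
  shows "continuous_on I (\<lambda>t. c (\<rho> (t, y t)))"
  using continuous_along[OF assms(1) Ck_on_imp_continuous_on[OF \<rho>]] smooth_curveD(4)[OF assms(1)]
  by (intro continuous_on_compose2[OF assms(2)]) auto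

text \<open>The key identity multiplied by \<open>R\<^sup>2\<^sup>n\<^sup>-\<^sup>1\<close> persists in the limit at a simple zero of \<open>R\<close>. There
  the right-hand side \<open>a\<^sub>n J R\<^sup>n\<^sup>-\<^sup>2 \<Omega>\<^sup>n[y]\<close> vanishes, whereas on the left only the numerator of the
  highest derivative remains, and this is a nonzero multiple of \<open>S R'\<^sup>n\<^sup>-\<^sup>1\<close>.\<close>

lemma rho_y_zero:
  assumes "q \<in> V"
  shows "pd_y \<rho> q = 0"
proof (rule ccontr)
  assume \<rho>y: "pd_y \<rho> q \<noteq> 0"
  obtain x0 y0 where q: "q = (x0, y0)" by fastforce
  obtain I y where I: "x0 \<in> I" and y: "smooth_curve n V I y"
    and R0: "R y x0 = 0" "deriv (R y) x0 \<noteq> 0" and S0: "S y x0 \<noteq> 0"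
    using critical_curve[of x0 y0] assms \<rho>y unfolding q by metis
  obtain m where m: "n = Suc (Suc m)" "m \<ge> 1" by (rule n_ge_3E)
  note D = smooth_curveD[OF y]
  \<comment> \<open>The difference of the two sides of the key identity times \<open>R\<^sup>2\<^sup>n\<^sup>-\<^sup>1\<close>, with \<open>n = m + 2\<close>.\<close>
  define \<Theta> where "\<Theta> = (\<lambda>t.
     (\<Sum>k<n. a (Suc k) (\<rho> (t, y t)) * quot_numer (R y) (S y) k t * R y t ^ (2 * (Suc m - k)))
     + (a 0 (\<rho> (t, y t)) * \<psi> (t, y t) - b (\<rho> (t, y t))) * R y t ^ (2 * m + 3)
     - a n (\<rho> (t, y t)) * jac \<rho> \<psi> (t, y t) * R y t ^ m * Om F y n t)"
  have \<Theta>0: "\<Theta> t = 0" if "t \<in> I" "R y t \<noteq> 0" for t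
  proof -
    have 1: "quot_numer (R y) (S y) k t / R y t ^ (2 * k + 1) * R y t ^ (2 * m + 3) = quot_numer (R y) (S y) k t * R y t ^ (2 * (Suc m - k))"
      if "k < n" for k
    proof -
      have "2 * m + 3 = (2 * k + 1) + 2 * (Suc m - k)" using that m by auto
      then have "R y t ^ (2 * m + 3) = R y t ^ (2 * k + 1) * R y t ^ (2 * (Suc m - k))"
        by (metis power_add)
      then show ?thesis using \<open>R y t \<noteq> 0\<close> by (simp del: power_Suc)
    qed
    have 2: "jac \<rho> \<psi> (t, y t) / R y t ^ (n + 1) * R y t ^ (2 * m + 3) = jac \<rho> \<psi> (t, y t) * R y t ^ m"
    proof -
      have "2 * m + 3 = (n + 1) + m" using m by auto
      then have "R y t ^ (2 * m + 3) = R y t ^ (n + 1) * R y t ^ m"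
        by (metis power_add)
      then show ?thesis using \<open>R y t \<noteq> 0\<close> by (simp del: power_Suc)
    qed
    have "L y t * R y t ^ (2 * m + 3)
      = (\<Sum>k<n. a (Suc k) (\<rho> (t, y t)) * (quot_numer (R y) (S y) k t / R y t ^ (2 * k + 1) * R y t ^ (2 * m + 3)))
        + (a 0 (\<rho> (t, y t)) * \<psi> (t, y t) - b (\<rho> (t, y t))) * R y t ^ (2 * m + 3)"
      by (simp add: algebra_simps sum_distrib_left sum_distrib_right del: power_Suc)
    also have "\<dots> = (\<Sum>k<n. a (Suc k) (\<rho> (t, y t)) * quot_numer (R y) (S y) k t * R y t ^ (2 * (Suc m - k)))
        + (a 0 (\<rho> (t, y t)) * \<psi> (t, y t) - b (\<rho> (t, y t))) * R y t ^ (2 * m + 3)"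
      by (intro arg_cong2[where f = "(+)"] sum.cong refl) (simp only: lessThan_iff 1 mult.assoc)
    finally have "\<Theta> t = L y t * R y t ^ (2 * m + 3)
       - a n (\<rho> (t, y t)) * (jac \<rho> \<psi> (t, y t) / R y t ^ (n + 1) * R y t ^ (2 * m + 3)) * Om F y n t"
      unfolding 2 by (simp add: \<Theta>_def mult.assoc)
    also have "\<dots> = 0" unfolding key_identity[OF y that] by (simp add: mult_ac)
    finally show ?thesis .
  qed
  have CR: "Ck_on (Suc m) (R y) I" "Ck_on (Suc m) (S y) I"
    using m by (auto intro!: Ck_R_S[OF y])
  have "continuous_on I (\<lambda>t. jac \<rho> \<psi> (t, y t))"
    using \<rho> \<psi> unfolding m jac_def
    by (intro continuous_along[OF y] continuous_intros) (auto intro: Ck_on_imp_continuous_on Ck_pd[OF V])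
  moreover have "continuous_on I (Om F y n)"
    using Ck_Om[OF y F, of n 0] by (simp add: Ck_on.simps)
  moreover have "continuous_on I (quot_numer (R y) (S y) k)" if "k < n" for k
    using that m by (intro Ck_on_imp_continuous_on[OF Ck_quot_numer[OF D(2) CR, of k 0]]) auto
  moreover have "continuous_on I (R y)" by (rule Ck_on_imp_continuous_on[OF CR(1)])
  moreover have "continuous_on I (\<lambda>t. b (\<rho> (t, y t)))" "\<And>k. k \<le> n \<Longrightarrow> continuous_on I (\<lambda>t. a k (\<rho> (t, y t)))"
    using coeffs by (auto simp: linear_coeffs_on_def intro: continuous_coeff[OF y])
  moreover have "continuous_on I (\<lambda>t. \<psi> (t, y t))"
    by (rule continuous_along[OF y Ck_on_imp_continuous_on[OF \<psi>]])
  ultimately have "continuous_on I \<Theta>"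
    unfolding \<Theta>_def by (intro continuous_intros) auto
  then have lim: "(\<Theta> \<longlongrightarrow> \<Theta> x0) (at x0)"
    using I D(2) by (simp add: continuous_on_eq_continuous_at isCont_def)
  have "\<forall>\<^sub>F t in at x0. \<Theta> t = 0"
  proof -
    have "(R y has_real_derivative deriv (R y) x0) (at x0)"
      by (rule Ck_on_DERIV[OF D(2) CR(1) _ I]) simp
    then have "((\<lambda>t. R y t / (t - x0)) \<longlongrightarrow> deriv (R y) x0) (at x0)"
      by (simp add: has_field_derivative_iff R0)
    then have "\<forall>\<^sub>F t in at x0. R y t / (t - x0) \<noteq> 0"
      by (rule tendsto_imp_eventually_ne[OF _ R0(2)])
    moreover have "\<forall>\<^sub>F t in at x0. t \<in> I"
      using I D(2) by (simp add: eventually_at_in_open')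
    ultimately show ?thesis by eventually_elim (auto intro: \<Theta>0)
  qed
  then have "(\<Theta> \<longlongrightarrow> 0) (at x0)" by (rule tendsto_eventually)
  with lim have "\<Theta> x0 = 0" using tendsto_unique trivial_limit_at by blast
  moreover have "\<Theta> x0 = a n (\<rho> (x0, y x0)) * quot_numer (R y) (S y) (Suc m) x0"
  proof -
    have "(\<Sum>k<n. a (Suc k) (\<rho> (x0, y x0)) * quot_numer (R y) (S y) k x0 * R y x0 ^ (2 * (Suc m - k)))
      = (\<Sum>k\<in>{Suc m}. a (Suc k) (\<rho> (x0, y x0)) * quot_numer (R y) (S y) k x0 * R y x0 ^ (2 * (Suc m - k)))"
      using m R0 by (intro sum.mono_neutral_right) auto
    then show ?thesis using m R0 unfolding \<Theta>_def by (simp add: power_0_left del: quot_numer.simps)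
  qed
  moreover have "quot_numer (R y) (S y) k x0 \<noteq> 0" for k
    by (induction k) (use R0 S0 in auto)
  ultimately show False using coeff_n_nonzero[OF D(4)[OF I]] by (metis mult_eq_0_iff)
qed

section \<open>The new dependent variable is affine in \<open>y\<close>\<close>

text \<open>Now that \<open>\<rho>\<close> depends on \<open>x\<close> only, \<open>R\<close> is the same function for all curves. So at the fixed
  abscissa \<open>x\<^sub>0\<close> the left-hand side of the linear equation is a linear combination of the derivatives
  of \<open>\<psi>(x, y(x))\<close> whose coefficients are numbers independent of the curve.\<close>

lemma reduced_identity:
  assumes q: "(x0, y0) \<in> V"
  obtains d C b0 where "d > 0" "box d x0 y0 \<subseteq> V" "C n \<noteq> 0"
    "\<And>K y. x0 \<in> K \<Longrightarrow> smooth_curve n (box d x0 y0) K y \<Longrightarrow>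
      (\<Sum>i\<le>n. C i * (deriv ^^ i) (along \<psi> y) x0) - b0 = C n * pd_y \<psi> (x0, y x0) * Om F y n x0"
proof -
  obtain d where d: "d > 0" "box d x0 y0 \<subseteq> V" using box_in_open[OF V q] by blast
  obtain N where N: "n = Suc N" using n by (cases n) auto
  define X where "X = {x0 - d<..<x0 + d}"
  have \<rho>_eq: "\<rho> (x, y) = \<rho> (x, y0)" if "(x, y) \<in> box d x0 y0" for x y
  proof (rule constant_in_y[where Y = "{y0 - d<..<y0 + d}" and g = "\<lambda>t. \<rho> (x, t)"])
    show "((\<lambda>t. \<rho> (x, t)) has_real_derivative 0) (at t)" if "t \<in> {y0 - d<..<y0 + d}" for t
    proof -
      have "(x, t) \<in> V" using d that \<open>(x, y) \<in> box d x0 y0\<close> by (auto simp: box_def)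
      then show ?thesis using pd_DERIV(1)[OF V \<rho>[unfolded N], of x t] rho_y_zero[of "(x, t)"] by simp
    qed
  qed (use d that in \<open>auto simp: box_def\<close>)
  define r where "r = deriv (\<lambda>x. \<rho> (x, y0))"
  have X: "open X" "x0 \<in> X" using d by (auto simp: X_def)
  have "Ck_on n (\<lambda>x. \<rho> (x, y0)) X"
    by (rule Ck_on_along[OF V X(1) _ \<rho> Ck_on_const]) (use d in \<open>auto simp: X_def box_def\<close>)
  then have r: "Ck_on N r X" unfolding r_def N using X by (intro Ck_on_deriv)
  have r0: "r x0 = pd_x \<rho> (x0, y0)"
    unfolding r_def by (simp add: pd_x_def)
  have "pd_x \<rho> (x0, y0) \<noteq> 0" using jac[OF q] rho_y_zero[OF q] by (simp add: jac_def)
  define \<zeta> where "\<zeta> = \<rho> (x0, y0)"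
  have "jet_functional X x0 N N (a n \<zeta> * r x0 ^ N / r x0 ^ (2 * N + 1))
      (\<lambda>S. \<Sum>k<n. a (Suc k) \<zeta> * (quot_numer r S k x0 / r x0 ^ (2 * k + 1)))"
    using jet_functional_image[OF X(1) r, where a = "\<lambda>k. a k \<zeta>" and x = x0] unfolding N[symmetric] .
  then obtain D where D: "D N = a n \<zeta> * r x0 ^ N / r x0 ^ (2 * N + 1)"
    "\<And>K S. open K \<Longrightarrow> x0 \<in> K \<Longrightarrow> K \<subseteq> X \<Longrightarrow> Ck_on N S K \<Longrightarrow>
       (\<Sum>k<n. a (Suc k) \<zeta> * (quot_numer r S k x0 / r x0 ^ (2 * k + 1))) = (\<Sum>i\<le>N. D i * (deriv ^^ i) S x0)"
    unfolding jet_functional_def by blast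
  \<comment> \<open>\<open>D\<close> acts on \<open>S = u'\<close>; the index shift turns it into an expression in \<open>u\<close>.\<close>
  define C where "C = (\<lambda>i. if i = 0 then a 0 \<zeta> else D (i - 1))"
  have Cn: "C n = a n \<zeta> / r x0 ^ n"
  proof -
    have "r x0 ^ (2 * N + 1) = r x0 ^ N * r x0 ^ n" by (simp add: N mult_2 power_add)
    then show ?thesis using \<open>pd_x \<rho> (x0, y0) \<noteq> 0\<close> by (simp add: C_def N D(1)[unfolded N] r0)
  qed
  show thesis
  proof (rule that[OF d])
    show "C n \<noteq> 0" using coeff_n_nonzero[OF q] \<open>pd_x \<rho> (x0, y0) \<noteq> 0\<close> by (simp add: Cn \<zeta>_def r0)
    fix K y assume K: "x0 \<in> K" and y: "smooth_curve n (box d x0 y0) K y"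
    note Dy = smooth_curveD[OF y]
    have yV: "smooth_curve n V K y" using y V d(2) unfolding smooth_curve_def by blast
    have KX: "K \<subseteq> X" using Dy(4) by (auto simp: X_def box_def)
    have R_eq: "R y x = r x" if "x \<in> K" for x
    proof -
      have "\<forall>\<^sub>F t in nhds x. along \<rho> y t = \<rho> (t, y0)"
        using \<rho>_eq Dy(2,4) that by (auto simp: along_def eventually_nhds)
      then show ?thesis unfolding r_def by (intro deriv_cong_ev) auto
    qed
    have "quot_numer (R y) (S y) k x = quot_numer r (S y) k x" if "x \<in> K" for k x
      using that
    proof (induction k arbitrary: x)
      case (Suc k)
      have "\<forall>\<^sub>F t in nhds x. quot_numer (R y) (S y) k t = quot_numer r (S y) k t"
        using Suc Dy(2) by (auto simp: eventually_nhds)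
      moreover have "\<forall>\<^sub>F t in nhds x. R y t = r t"
        using R_eq Suc.prems Dy(2) by (auto simp: eventually_nhds)
      ultimately show ?case using Suc.IH[OF Suc.prems] R_eq[OF Suc.prems]
        by (simp cong: deriv_cong_ev)
    qed simp
    note num_eq = this[OF K]
    have z: "\<rho> (x0, y x0) = \<zeta>" using \<rho>_eq Dy(4)[OF K] by (simp add: \<zeta>_def)
    have nz: "R y x0 \<noteq> 0" using R_eq[OF K] r0 \<open>pd_x \<rho> (x0, y0) \<noteq> 0\<close> by simp
    have "(\<Sum>i\<le>n. C i * (deriv ^^ i) (along \<psi> y) x0)
       = a 0 \<zeta> * \<psi> (x0, y x0) + (\<Sum>i\<le>N. D i * (deriv ^^ i) (S y) x0)"
      unfolding N sum.atMost_Suc_shift by (simp add: C_def along_def higher_deriv_Suc del: funpow.simps)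
    also have "(\<Sum>i\<le>N. D i * (deriv ^^ i) (S y) x0) = (\<Sum>k<n. a (Suc k) \<zeta> * (quot_numer r (S y) k x0 / r x0 ^ (2 * k + 1)))"
      by (rule D(2)[symmetric, OF Dy(2) K KX]) (auto intro: Ck_R_S[OF yV] simp: N)
    finally have "(\<Sum>i\<le>n. C i * (deriv ^^ i) (along \<psi> y) x0) - b \<zeta> = L y x0"
      by (simp add: z num_eq R_eq[OF K])
    also have "\<dots> = a n \<zeta> * jac \<rho> \<psi> (x0, y x0) / R y x0 ^ (n + 1) * Om F y n x0"
      using key_identity[OF yV K nz] by (simp add: z)
    also have "jac \<rho> \<psi> (x0, y x0) = R y x0 * pd_y \<psi> (x0, y x0)"
      using rho_y_zero[of "(x0, y x0)"] smooth_curveD(4)[OF yV K] by (simp add: R_S_eq[OF yV K] jac_def)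
    finally show "(\<Sum>i\<le>n. C i * (deriv ^^ i) (along \<psi> y) x0) - b \<zeta> = C n * pd_y \<psi> (x0, y x0) * Om F y n x0"
      using nz unfolding Cn by (simp add: R_eq[OF K])
  qed
qed

text \<open>The coefficient of \<open>y\<^sup>(\<^sup>n\<^sup>-\<^sup>1\<^sup>)\<close> in the reduced identity contains \<open>n \<psi>\<^sub>y\<^sub>y y'\<close> on the left and nothing
  that depends on \<open>y'\<close> on the right. Comparing it for lines of slope 0 and 1 gives the claim.\<close>

lemma psi_yy_zero:
  assumes "q \<in> V"
  shows "pd_y (pd_y \<psi>) q = 0"
proof -
  obtain x0 y0 where q: "q = (x0, y0)" by fastforce
  obtain m where m: "n = Suc (Suc m)" "m \<ge> 1" by (rule n_ge_3E)
  obtain d C b0 where d: "d > 0" "box d x0 y0 \<subseteq> V" "C n \<noteq> 0"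
    and id: "\<And>K y. x0 \<in> K \<Longrightarrow> smooth_curve n (box d x0 y0) K y \<Longrightarrow>
      (\<Sum>i\<le>n. C i * (deriv ^^ i) (along \<psi> y) x0) - b0 = C n * pd_y \<psi> (x0, y x0) * Om F y n x0"
    using reduced_identity[of x0 y0] assms unfolding q by blast
  have sub: "Ck_on n F (box d x0 y0)" "Ck_on n \<psi> (box d x0 y0)"
    using F \<psi> d(2) by (auto intro: Ck_on_subset)
  have q': "(x0, y0) \<in> box d x0 y0" using in_box_vertical[of d y0 y0] d(1) by simp
  have key: "C n * (pd_y (pd_x \<psi>) q + pd_y (pd_y \<psi>) q * s
       + real (Suc m) * (pd_x (pd_y \<psi>) q + pd_y (pd_y \<psi>) q * s)) + C (Suc m) * pd_y \<psi> q
     = C n * pd_y \<psi> q * (real n * F q + y0 * pd_y F q)" for s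
  proof -
    define y where "y = (\<lambda>t. y0 + s * (t - x0))"
    define y' where "y' = (\<lambda>t. y t + 1 / fact (Suc m) * (t - x0) ^ Suc m)"
    obtain I where I: "x0 \<in> I" "smooth_curve n (box d x0 y0) I y"
      using curve_with_slope[OF open_box q', of n s] unfolding y_def by blast
    obtain K where K: "x0 \<in> K" "smooth_curve n (box d x0 y0) K y" "smooth_curve n (box d x0 y0) K y'"
      using smooth_curve_perturb[OF I(2,1), of "Suc m" 1] unfolding y'_def by blast
    note D = smooth_curveD[OF K(2)]
    have dy: "(deriv ^^ j) y' x0 = (deriv ^^ j) y x0 + (if j = Suc m then 1 else 0)" if "j \<le> n" for j
      unfolding y'_def using that by (intro higher_deriv_perturb[OF D(2,3) K(1)])
    have y0: "y x0 = y0" "deriv y x0 = s" by (simp_all add: y_def deriv_line)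
    have J: "jet_eq m y y' x0" using dy m by (auto simp: jet_eq_def)
    have y0': "y' x0 = y0" using jet_eq_value[OF J] y0 by simp
    have m': "smooth_curve (Suc m) (box d x0 y0) K y" "smooth_curve (Suc m) (box d x0 y0) K y'"
      "Ck_on (Suc m) \<psi> (box d x0 y0)"
      using m sub by (auto intro: smooth_curve_mono[OF K(2)] smooth_curve_mono[OF K(3)] Ck_on_mono)
    have J\<psi>: "jet_eq m (along \<psi> y) (along \<psi> y') x0"
      using m by (intro jet_along_eq[OF K(2,3) _ K(1) J]) (auto intro: Ck_on_mono[OF sub(2)])
    have 1: "(deriv ^^ Suc m) (along \<psi> y') x0 - (deriv ^^ Suc m) (along \<psi> y) x0 = pd_y \<psi> q"
      using jet_along_diff[OF m' K(1) J] dy[of "Suc m"] m by (simp add: y0 q del: funpow.simps)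
    have 2: "(deriv ^^ n) (along \<psi> y') x0 - (deriv ^^ n) (along \<psi> y) x0
      = pd_y (pd_x \<psi>) q + pd_y (pd_y \<psi>) q * s + real (Suc m) * (pd_x (pd_y \<psi>) q + pd_y (pd_y \<psi>) q * s)"
      using jet_along_diff2[OF K(2,3)[unfolded m] sub(2)[unfolded m] K(1) J m(2)] dy[of n] dy[of "Suc m"] m
      by (simp add: y0 q del: funpow.simps of_nat_Suc)
    have 3: "Om F y' n x0 - Om F y n x0 = real n * F q + y0 * pd_y F q"
      using jet_Om_diff2[OF K(2,3) sub(1) K(1), of n 0 m] J dy[of n] dy[of "Suc m"] m
      by (simp add: y0 q del: funpow.simps of_nat_Suc)
    have "(\<Sum>i\<le>m. C i * (deriv ^^ i) (along \<psi> y') x0) = (\<Sum>i\<le>m. C i * (deriv ^^ i) (along \<psi> y) x0)"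
      by (intro sum.cong refl) (simp add: jet_eqD[OF J\<psi>])
    then have "(\<Sum>i\<le>n. C i * (deriv ^^ i) (along \<psi> y') x0) - (\<Sum>i\<le>n. C i * (deriv ^^ i) (along \<psi> y) x0)
      = C n * ((deriv ^^ n) (along \<psi> y') x0 - (deriv ^^ n) (along \<psi> y) x0)
        + C (Suc m) * ((deriv ^^ Suc m) (along \<psi> y') x0 - (deriv ^^ Suc m) (along \<psi> y) x0)"
      by (simp add: m(1) algebra_simps del: funpow.simps)
    moreover have "(\<Sum>i\<le>n. C i * (deriv ^^ i) (along \<psi> y') x0) - (\<Sum>i\<le>n. C i * (deriv ^^ i) (along \<psi> y) x0)
      = C n * pd_y \<psi> q * (Om F y' n x0 - Om F y n x0)"
      using id[OF K(1,2)] id[OF K(1,3)] by (simp add: y0 y0' q right_diff_distrib)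
    ultimately show ?thesis unfolding 1 2 3 by simp
  qed
  have "C n * (real (Suc (Suc m)) * pd_y (pd_y \<psi>) q) = 0"
    using key[of 1] key[of 0] by (simp add: algebra_simps)
  then show ?thesis using d(3) by (simp del: of_nat_Suc)
qed

lemma psi_affine:
  assumes d: "d > 0" "box d x0 y0 \<subseteq> V"
  obtains \<alpha> where "Ck_on n \<alpha> {x0 - d<..<x0 + d}"
    "\<And>x y. (x, y) \<in> box d x0 y0 \<Longrightarrow> \<psi> (x, y) = \<psi> (x, y0) + (y - y0) * \<alpha> x"
    "\<And>x y. (x, y) \<in> box d x0 y0 \<Longrightarrow> pd_y \<psi> (x, y) = \<alpha> x"
proof -
  obtain m where m: "n = Suc (Suc m)" by (rule n_ge_3E)
  let ?X = "{x0 - d<..<x0 + d}" and ?Y = "{y0 - d<..<y0 + d}"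
  have in_V: "(x, y) \<in> V" if "x \<in> ?X" "y \<in> ?Y" for x y using d that by (auto simp: box_def)
  have Y: "y0 \<in> ?Y" "y0 + d / 2 \<in> ?Y" using d by auto
  \<comment> \<open>A difference quotient instead of \<open>\<psi>\<^sub>y\<close>: the two agree, but here one sees that \<open>\<alpha>\<close> is of class \<open>C\<^sup>n\<close>.\<close>
  define \<alpha> where "\<alpha> = (\<lambda>x. (2 / d) * (\<psi> (x, y0 + d / 2) - \<psi> (x, y0)))"
  have py: "pd_y \<psi> (x, y) = pd_y \<psi> (x, y0)" if "x \<in> ?X" "y \<in> ?Y" for x y
  proof (rule constant_in_y[where Y = ?Y and g = "\<lambda>t. pd_y \<psi> (x, t)"])
    fix t assume "t \<in> ?Y"
    then have "(x, t) \<in> V" using that in_V by blast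
    then show "((\<lambda>t. pd_y \<psi> (x, t)) has_real_derivative 0) (at t)"
      using pd_DERIV(1)[OF V Ck_pd(2)[OF V \<psi>[unfolded m]], of x t] psi_yy_zero[of "(x, t)"] by simp
  qed (use that Y in auto)
  have aff: "\<psi> (x, y) = \<psi> (x, y0) + (y - y0) * pd_y \<psi> (x, y0)" if "x \<in> ?X" "y \<in> ?Y" for x y
  proof -
    have "\<psi> (x, y) - y * pd_y \<psi> (x, y0) = \<psi> (x, y0) - y0 * pd_y \<psi> (x, y0)"
    proof (rule constant_in_y[where Y = ?Y and g = "\<lambda>t. \<psi> (x, t) - t * pd_y \<psi> (x, y0)"])
      fix t assume t: "t \<in> ?Y"
      then have "(x, t) \<in> V" using that in_V by blast
      then show "((\<lambda>t. \<psi> (x, t) - t * pd_y \<psi> (x, y0)) has_real_derivative 0) (at t)"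
        using pd_DERIV(1)[OF V \<psi>[unfolded m], of x t] py[OF that(1) t]
        by (auto intro!: derivative_eq_intros)
    qed (use that Y in auto)
    then show ?thesis by (simp add: algebra_simps)
  qed
  have \<alpha>_eq: "\<alpha> x = pd_y \<psi> (x, y0)" if "x \<in> ?X" for x
    using aff[OF that Y(2)] d(1) by (simp add: \<alpha>_def)
  have "Ck_on n (\<lambda>x. \<psi> (x, c)) ?X" if "c \<in> ?Y" for c
    by (rule Ck_on_along[OF V _ _ \<psi> Ck_on_const]) (use in_V that in auto)
  then have "Ck_on n \<alpha> ?X"
    unfolding \<alpha>_def using Y by (intro Ck_on_mult Ck_on_diff Ck_on_const) auto
  then show thesis
  proof (rule that)
    fix x y assume "(x, y) \<in> box d x0 y0"
    then have "x \<in> ?X" "y \<in> ?Y" by (auto simp: box_def)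
    then show "\<psi> (x, y) = \<psi> (x, y0) + (y - y0) * \<alpha> x" "pd_y \<psi> (x, y) = \<alpha> x"
      using aff[of x y] py[of x y] \<alpha>_eq[of x] by simp_all
  qed
qed

section \<open>The coefficient \<open>F\<close> does not depend on \<open>y\<close>\<close>

text \<open>Since \<open>\<psi>(x, y(x))\<close> is affine in \<open>y\<close>, so is the left-hand side of the reduced identity,
  and with it \<open>\<Omega>\<^sup>n[y]\<close> at \<open>x\<^sub>0\<close> as a function of the curve. The first claim is that the coefficient
  of \<open>y\<^sup>(\<^sup>n\<^sup>-\<^sup>1\<^sup>)\<close> does not depend on the value of \<open>y\<close>, the second one is the restriction to lines.\<close>

lemma Om_affine:
  assumes q: "(x0, y0) \<in> V"
  shows "pd_y (\<lambda>p. real n * F p + snd p * pd_y F p) (x0, y0) = 0" (is ?A)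
    and "\<exists>A B. \<forall>s. Om F (\<lambda>t. y0 + s * (t - x0)) n x0 = A + B * s" (is ?B)
proof -
  obtain m where m: "n = Suc (Suc m)" "m \<ge> 1" by (rule n_ge_3E)
  obtain d C b0 where d: "d > 0" "box d x0 y0 \<subseteq> V" "C n \<noteq> 0"
    and id: "\<And>K y. x0 \<in> K \<Longrightarrow> smooth_curve n (box d x0 y0) K y \<Longrightarrow>
      (\<Sum>i\<le>n. C i * (deriv ^^ i) (along \<psi> y) x0) - b0 = C n * pd_y \<psi> (x0, y x0) * Om F y n x0"
    using reduced_identity[OF q] by blast
  let ?V = "box d x0 y0" and ?X = "{x0 - d<..<x0 + d}"
  obtain \<alpha> where \<alpha>: "Ck_on n \<alpha> ?X"
    "\<And>x y. (x, y) \<in> ?V \<Longrightarrow> \<psi> (x, y) = \<psi> (x, y0) + (y - y0) * \<alpha> x"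
    "\<And>x y. (x, y) \<in> ?V \<Longrightarrow> pd_y \<psi> (x, y) = \<alpha> x"
    using psi_affine[OF d(1,2)] by blast
  define \<Lambda> where "\<Lambda> = (\<lambda>u. \<Sum>i\<le>n. C i * (deriv ^^ i) u x0)"
  have sub: "Ck_on n F ?V" "Ck_on n \<psi> ?V"
    using F \<psi> d(2) by (auto intro: Ck_on_subset)
  \<comment> \<open>The value \<open>C\<^sub>n \<psi>\<^sub>y\<close> of the factor on the right of the reduced identity, constant along \<open>x = x\<^sub>0\<close>.\<close>
  define \<kappa> where "\<kappa> = C n * \<alpha> x0"
  have "\<kappa> \<noteq> 0"
    using jac[OF q] rho_y_zero[OF q] \<alpha>(3)[of x0 y0] in_box_vertical[of d y0 y0 x0] d by (auto simp: jac_def \<kappa>_def)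
  have step: "\<kappa> * (Om F y' n x0 - Om F y n x0) = c * \<Lambda> (\<lambda>t. \<alpha> t * p t)"
    if K: "x0 \<in> K" and y: "smooth_curve n ?V K y" "smooth_curve n ?V K y'"
      and y': "\<And>t. y' t = y t + c * p t" and p: "Ck_on n p K" for K y y' c p
  proof -
    note D = smooth_curveD[OF y(1)] smooth_curveD[OF y(2)]
    have KX: "K \<subseteq> ?X" using D(4) by (auto simp: box_def)
    have C\<alpha>: "Ck_on n (\<lambda>t. \<alpha> t * p t) K"
      by (rule Ck_on_mult[OF D(2) Ck_on_subset[OF \<alpha>(1) KX] p])
    have "(deriv ^^ i) (along \<psi> y') x0 = (deriv ^^ i) (along \<psi> y) x0 + c * (deriv ^^ i) (\<lambda>t. \<alpha> t * p t) x0"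
      if "i \<le> n" for i
    proof -
      have "(deriv ^^ i) (along \<psi> y') x0 = (deriv ^^ i) (\<lambda>t. 1 * along \<psi> y t + c * (\<alpha> t * p t)) x0"
      proof (rule higher_deriv_cong[OF D(2) _ K])
        fix t assume t: "t \<in> K"
        show "along \<psi> y' t = 1 * along \<psi> y t + c * (\<alpha> t * p t)"
          using \<alpha>(2)[OF D(4)[OF t]] \<alpha>(2)[OF D(8)[OF t]] y'[of t] by (simp add: along_def algebra_simps)
      qed
      also have "\<dots> = 1 * (deriv ^^ i) (along \<psi> y) x0 + c * (deriv ^^ i) (\<lambda>t. \<alpha> t * p t) x0"
        using that by (intro higher_deriv_lincomb[OF D(2) _ _ K])
          (auto intro: Ck_on_mono[OF C\<alpha>] Ck_along[OF y(1)] Ck_on_mono[OF sub(2)])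
      finally show ?thesis by simp
    qed
    then have "\<Lambda> (along \<psi> y') = (\<Sum>i\<le>n. C i * (deriv ^^ i) (along \<psi> y) x0 + c * (C i * (deriv ^^ i) (\<lambda>t. \<alpha> t * p t) x0))"
      unfolding \<Lambda>_def by (intro sum.cong refl) (simp add: algebra_simps)
    also have "\<dots> = \<Lambda> (along \<psi> y) + c * \<Lambda> (\<lambda>t. \<alpha> t * p t)"
      by (simp add: \<Lambda>_def sum.distrib sum_distrib_left)
    finally have "\<Lambda> (along \<psi> y') - \<Lambda> (along \<psi> y) = c * \<Lambda> (\<lambda>t. \<alpha> t * p t)" by simp
    moreover have "\<Lambda> (along \<psi> y) - b0 = \<kappa> * Om F y n x0" "\<Lambda> (along \<psi> y') - b0 = \<kappa> * Om F y' n x0"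
      using id[OF K y(1)] id[OF K y(2)] \<alpha>(3)[OF D(4)[OF K]] \<alpha>(3)[OF D(8)[OF K]]
      by (simp_all add: \<Lambda>_def \<kappa>_def)
    ultimately show ?thesis by (simp add: right_diff_distrib)
  qed
  let ?p = "\<lambda>t. 1 / fact (Suc m) * (t - x0) ^ Suc m"
  have const: "real n * F (x0, y) + y * pd_y F (x0, y) = \<Lambda> (\<lambda>t. \<alpha> t * ?p t) / \<kappa>" if y: "\<bar>y - y0\<bar> < d" for y
  proof -
    define u where "u = (\<lambda>t. y + 0 * (t - x0))"
    define u' where "u' = (\<lambda>t. u t + 1 / fact (Suc m) * (t - x0) ^ Suc m)"
    obtain I where I: "x0 \<in> I" "smooth_curve n ?V I u"
      using curve_with_slope[OF open_box in_box_vertical[OF d(1) y, of x0], of n 0] unfolding u_def by blast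
    obtain K where K: "x0 \<in> K" "smooth_curve n ?V K u" "smooth_curve n ?V K u'"
      using smooth_curve_perturb[OF I(2,1), of "Suc m" 1] unfolding u'_def by blast
    note D = smooth_curveD[OF K(2)]
    have du: "(deriv ^^ j) u' x0 = (deriv ^^ j) u x0 + (if j = Suc m then 1 else 0)" if "j \<le> n" for j
      unfolding u'_def using that by (intro higher_deriv_perturb[OF D(2,3) K(1)])
    have J: "jet_eq m u u' x0" using du m by (auto simp: jet_eq_def)
    have u0: "u x0 = y" by (simp add: u_def)
    have "Om F u' n x0 - Om F u n x0 = real n * F (x0, y) + y * pd_y F (x0, y)"
      using jet_Om_diff2[OF K(2,3) sub(1) K(1), of n 0 m] J du[of n] du[of "Suc m"] m
      by (simp add: u0 del: funpow.simps of_nat_Suc)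
    moreover have "\<kappa> * (Om F u' n x0 - Om F u n x0) = 1 * \<Lambda> (\<lambda>t. \<alpha> t * ?p t)"
    proof (rule step[OF K])
      show "u' t = u t + 1 * (1 / fact (Suc m) * (t - x0) ^ Suc m)" for t
        unfolding u'_def mult_1_left ..
    qed (rule Ck_centred_power[OF D(2)])
    ultimately show ?thesis using \<open>\<kappa> \<noteq> 0\<close> by (simp add: field_simps)
  qed
  have "\<forall>\<^sub>F y in nhds y0. real n * F (x0, y) + y * pd_y F (x0, y) = \<Lambda> (\<lambda>t. \<alpha> t * ?p t) / \<kappa>"
    using d(1) const by (auto simp: eventually_nhds_metric dist_real_def)
  then have "deriv (\<lambda>y. real n * F (x0, y) + y * pd_y F (x0, y)) y0 = deriv (\<lambda>y. \<Lambda> (\<lambda>t. \<alpha> t * ?p t) / \<kappa>) y0"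
    by (intro deriv_cong_ev) auto
  then show ?A by (simp add: pd_y_def)
  have "Om F (\<lambda>t. y0 + s * (t - x0)) n x0 = Om F (\<lambda>t. y0 + 0 * (t - x0)) n x0 + \<Lambda> (\<lambda>t. \<alpha> t * (t - x0)) / \<kappa> * s" for s
  proof -
    have q': "(x0, y0) \<in> ?V" using in_box_vertical[of d y0 y0] d by simp
    obtain I where I: "x0 \<in> I" "smooth_curve n ?V I (\<lambda>t. y0 + s * (t - x0))"
      using curve_with_slope[OF open_box q', of n s] by blast
    obtain J where J: "x0 \<in> J" "smooth_curve n ?V J (\<lambda>t. y0 + 0 * (t - x0))"
      using curve_with_slope[OF open_box q', of n 0] by blast
    have o: "open (I \<inter> J)" using smooth_curveD(2)[OF I(2)] smooth_curveD(2)[OF J(2)] by auto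
    have "\<kappa> * (Om F (\<lambda>t. y0 + s * (t - x0)) n x0 - Om F (\<lambda>t. y0 + 0 * (t - x0)) n x0) = s * \<Lambda> (\<lambda>t. \<alpha> t * (t - x0))"
    proof (rule step[where K = "I \<inter> J"])
      show "smooth_curve n ?V (I \<inter> J) (\<lambda>t. y0 + 0 * (t - x0))"
        by (rule smooth_curve_subset[OF J(2) o]) auto
      show "smooth_curve n ?V (I \<inter> J) (\<lambda>t. y0 + s * (t - x0))"
        by (rule smooth_curve_subset[OF I(2) o]) auto
      show "Ck_on n (\<lambda>t. t - x0) (I \<inter> J)"
        using Ck_centred_power[OF o, of n 1 x0 1] by simp
    qed (use I J in auto)
    then show ?thesis using \<open>\<kappa> \<noteq> 0\<close> by (simp add: field_simps)
  qed
  then show ?B by blast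
qed

text \<open>The two parts of \<open>Om_affine\<close> are the two hypotheses of \<open>euler_rigidity\<close> for the slice
  \<open>t \<mapsto> F(x\<^sub>0, t)\<close>: a polynomial in \<open>s\<close> of degree at most one has no term in \<open>s\<^sup>n\<^sup>-\<^sup>1\<close>.\<close>

lemma F_y_zero:
  assumes "q \<in> V"
  shows "pd_y F q = 0"
proof -
  obtain x0 y0 where q: "q = (x0, y0)" by fastforce
  obtain m where m: "n = Suc (Suc m)" "m \<ge> 1" by (rule n_ge_3E)
  let ?Y = "{t. (x0, t) \<in> V}" and ?\<phi> = "\<lambda>t. F (x0, t)"
  note Y = Ck_slice[OF V F, of x0]
  have d\<phi>: "deriv ?\<phi> = (\<lambda>t. pd_y F (x0, t))" by (simp add: pd_y_def fun_eq_iff)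
  have "deriv ?\<phi> y0 = 0"
  proof (rule euler_rigidity[OF Y(1) Y(2)[unfolded m(1)] m(2)])
    fix t assume t: "t \<in> ?Y"
    then have tV: "(x0, t) \<in> V" by simp
    show "deriv (\<lambda>t. real (Suc (Suc m)) * ?\<phi> t + t * deriv ?\<phi> t) t = 0"
      using Om_affine(1)[OF tV] unfolding d\<phi> m(1) by (simp add: pd_y_def)
    obtain A B where AB: "\<And>s. Om F (\<lambda>u. t + s * (u - x0)) n x0 = A + B * s"
      using Om_affine(2)[OF tV] by blast
    have "(\<Sum>j\<le>n. (line_coeff F n j (x0, t) - (if j = 0 then A else if j = 1 then B else 0)) * s ^ j) = 0" for s
    proof -
      obtain I where I: "x0 \<in> I" "smooth_curve n V I (\<lambda>u. t + s * (u - x0))"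
        using curve_with_slope[OF V tV, of n s] by blast
      have "(\<Sum>j\<le>n. (if j = 0 then A else if j = 1 then B else 0) * s ^ j)
          = (\<Sum>j\<in>{0, 1}. (if j = 0 then A else if j = 1 then B else 0) * s ^ j)"
        using m by (intro sum.mono_neutral_right) auto
      then have "(\<Sum>j\<le>n. (if j = 0 then A else if j = 1 then B else 0) * s ^ j) = A + B * s" by simp
      moreover have "(\<Sum>j\<le>n. line_coeff F n j (x0, t) * s ^ j) = A + B * s"
        using Om_line[OF I(2) F order_refl I(1)] AB[of s] by simp
      ultimately show ?thesis by (simp only: left_diff_distrib sum_subtractf)
    qed
    then have "line_coeff F n (Suc m) (x0, t) - (if Suc m = 0 then A else if Suc m = 1 then B else 0) = 0"
      by (rule zero_polynom_imp_zero_coeffs) (simp add: m)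
    then have "line_coeff F n (Suc m) (x0, t) = 0" using m by simp
    then have "(deriv ^^ m) (\<lambda>t. pd_y (\<lambda>p. F p * snd p) (x0, t) + F (x0, t)) t = 0"
      unfolding m(1) line_coeff_subdiag higher_deriv_slice .
    moreover have "pd_y (\<lambda>p. F p * snd p) (x0, t) + F (x0, t) = 2 * ?\<phi> t + t * deriv ?\<phi> t" if "t \<in> ?Y" for t
    proof -
      have "((\<lambda>t. F (x0, t) * t) has_real_derivative pd_y F (x0, t) * t + 1 * F (x0, t)) (at t)"
        using that by (intro DERIV_mult DERIV_ident pd_DERIV(1)[OF V F[unfolded m(1)]]) auto
      then show ?thesis unfolding d\<phi> by (simp add: pd_y_def DERIV_imp_deriv)
    qed
    ultimately show "(deriv ^^ m) (\<lambda>t. 2 * ?\<phi> t + t * deriv ?\<phi> t) t = 0"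
      using higher_deriv_cong[OF Y(1) _ t] by (metis (no_types, lifting))
  qed (use assms q in simp)
  then show ?thesis using d\<phi> q by simp
qed

end

section \<open>The linear case and the equivalence\<close>

text \<open>The coefficients of \<open>(d/dx + f)\<^sup>k\<close> as a differential operator.\<close>

primrec lin_coeff :: "(real \<Rightarrow> real) \<Rightarrow> nat \<Rightarrow> nat \<Rightarrow> real \<Rightarrow> real" where
  "lin_coeff f 0 = (\<lambda>j x. if j = 0 then 1 else 0)"
| "lin_coeff f (Suc k) = (\<lambda>j x. deriv (lin_coeff f k j) x
     + (if j = 0 then 0 else lin_coeff f k (j - 1) x) + f x * lin_coeff f k j x)"

lemma lin_coeff_zero: "k < j \<Longrightarrow> lin_coeff f k j = (\<lambda>x. 0)"
proof (induction k arbitrary: j)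
  case (Suc k)
  then have 0: "lin_coeff f k j = (\<lambda>x. 0)" "lin_coeff f k (j - 1) = (\<lambda>x. 0)" by auto
  show ?case using Suc.prems 0 by (intro ext) simp
qed simp

lemma lin_coeff_diag: "lin_coeff f k k = (\<lambda>x. 1)"
  by (induction k) (auto simp: fun_eq_iff lin_coeff_zero)

lemma Ck_lin_coeff:
  assumes "open X" "Ck_on n f X" "k + i \<le> n"
  shows "Ck_on i (lin_coeff f k j) X"
  using assms(3)
proof (induction k arbitrary: i j)
  case 0
  then show ?case by simp
next
  case (Suc k)
  then have "Ck_on (Suc i) (lin_coeff f k j) X" "Ck_on i (lin_coeff f k j) X" for j by auto
  then show ?case using Suc.prems assms(1)
    by (cases "j = 0") (auto intro!: Ck_on_add Ck_on_mult Ck_on_deriv intro: Ck_on_mono[OF assms(2)])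
qed

lemma Om_linear:
  assumes y: "open I" "Ck_on n y I" and f: "Ck_on n f I" and F: "\<And>x. x \<in> I \<Longrightarrow> F (x, y x) = f x"
    and "k \<le> n" "x \<in> I"
  shows "Om F y k x = (\<Sum>j\<le>k. lin_coeff f k j x * (deriv ^^ j) y x)"
  using assms(5,6)
proof (induction k arbitrary: x)
  case 0
  then show ?case by simp
next
  case (Suc k)
  have d: "(lin_coeff f k j has_real_derivative deriv (lin_coeff f k j) x) (at x)" for j
    using Suc.prems by (intro Ck_on_DERIV[OF y(1) Ck_lin_coeff[OF y(1) f, of k 1]]) auto
  have dy: "((deriv ^^ j) y has_real_derivative (deriv ^^ Suc j) y x) (at x)" if "j \<le> k" for j
    using Ck_on_DERIV[OF y(1) Ck_on_higher_deriv[OF y(1), of j 1 y], of x] that Suc.prems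
      Ck_on_mono[OF y(2), of "j + 1"] by simp
  have "\<forall>\<^sub>F t in nhds x. Om F y k t = (\<Sum>j\<le>k. lin_coeff f k j t * (deriv ^^ j) y t)"
    using Suc y(1) by (auto simp: eventually_nhds)
  then have "deriv (Om F y k) x = deriv (\<lambda>t. \<Sum>j\<le>k. lin_coeff f k j t * (deriv ^^ j) y t) x"
    by (intro deriv_cong_ev) auto
  also have "\<dots> = (\<Sum>j\<le>k. deriv (lin_coeff f k j) x * (deriv ^^ j) y x + (deriv ^^ Suc j) y x * lin_coeff f k j x)"
    by (intro DERIV_imp_deriv DERIV_sum DERIV_mult d dy) auto
  finally have "Om F y (Suc k) x =
      (\<Sum>j\<le>k. (deriv (lin_coeff f k j) x + f x * lin_coeff f k j x) * (deriv ^^ j) y x)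
      + (\<Sum>j\<le>k. lin_coeff f k j x * (deriv ^^ Suc j) y x)"
    using Suc F by (simp add: Om_Suc along_def sum_distrib_left sum.distrib algebra_simps del: funpow.simps)
  also have "\<dots> = (\<Sum>j\<le>Suc k. lin_coeff f (Suc k) j x * (deriv ^^ j) y x)"
    by (subst sum_shift_index) (auto simp: lin_coeff_zero simp del: funpow.simps intro!: sum.cong)
  finally show ?case .
qed

lemma linear_at_if_F_y_zero:
  assumes U: "open U" "p \<in> U" and F: "Ck_on n F U" and n: "n > 0"
    and Fy: "\<forall>\<^sub>F q in nhds p. pd_y F q = 0"
  shows "linear_at n (Omega_iter F n) U p"
proof -
  obtain x0 y0 where p: "p = (x0, y0)" by fastforce
  obtain W where W: "open W" "p \<in> W" "\<And>q. q \<in> W \<Longrightarrow> pd_y F q = 0"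
    using Fy by (auto simp: eventually_nhds)
  obtain d where d: "d > 0" "box d x0 y0 \<subseteq> U \<inter> W"
    using box_in_open[of "U \<inter> W" x0 y0] U W p by auto
  let ?V = "box d x0 y0" and ?X = "{x0 - d<..<x0 + d}" and ?Y = "{y0 - d<..<y0 + d}"
  define f where "f = (\<lambda>x. F (x, y0))"
  obtain N where N: "n = Suc N" using n by (cases n) auto
  have Ff: "F (x, y) = f x" if "(x, y) \<in> ?V" for x y
    unfolding f_def
  proof (rule constant_in_y[where Y = ?Y and g = "\<lambda>t. F (x, t)"])
    fix t assume "t \<in> ?Y"
    with that have "(x, t) \<in> ?V" by (auto simp: box_def)
    then have t: "(x, t) \<in> U" "(x, t) \<in> W" using d(2) by auto
    show "((\<lambda>t. F (x, t)) has_real_derivative 0) (at t)"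
      using pd_DERIV(1)[OF U(1) F[unfolded N] t(1)] W(3)[OF t(2)] by simp
  qed (use that d in \<open>auto simp: box_def\<close>)
  have f: "Ck_on n f ?X" unfolding f_def
    by (rule Ck_on_along[OF U(1) _ _ F Ck_on_const]) (use d in \<open>auto simp: box_def\<close>)
  have V: "fst ` ?V = ?X" using d(1) by (auto simp: box_def)
  have "linear_coeffs_on n (lin_coeff f n) (\<lambda>x. 0) ?X"
    unfolding linear_coeffs_on_def
    by (auto intro!: Ck_on_imp_continuous_on[OF Ck_lin_coeff[OF _ f, of n 0]] simp: lin_coeff_diag)
  moreover have "Omega_iter F n y x = linear_ode n (lin_coeff f n) (\<lambda>x. 0) y x"
    if "curve_in n ?V I y" "x \<in> I" for I y x
  proof -
    have I: "open I" "Ck_on n y I" "\<And>x. x \<in> I \<Longrightarrow> (x, y x) \<in> ?V"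
      using that(1) by (auto simp: curve_in_def C_class_def)
    have "I \<subseteq> ?X" using I(3) by (auto simp: box_def)
    with I f Ff that(2) show ?thesis
      by (subst Om_linear[where I = I and n = n]) (auto simp: linear_ode_def intro: Ck_on_subset)
  qed
  ultimately show ?thesis
    unfolding linear_at_def using d U V p in_box_vertical[of d y0 y0 x0]
    by (intro exI[of _ ?V] exI[of _ "lin_coeff f n"] exI[of _ "\<lambda>x. 0"]) auto
qed

text \<open>The identity is a linearizing point transformation; \<open>w\<close> then agrees with \<open>y\<close> on the
  interval, hence so do their derivatives there.\<close>

lemma linearizable_if_linear_at:
  assumes "linear_at n E U p"
  shows "linearizable_at r n E U p"
proof -
  obtain V a b where V: "open V" "p \<in> V" "V \<subseteq> U" "linear_coeffs_on n a b (fst ` V)"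
    and E: "\<And>I y x. curve_in n V I y \<Longrightarrow> x \<in> I \<Longrightarrow> E y x = linear_ode n a b y x"
    using assms unfolding linear_at_def by blast
  have "point_transformation r V fst snd"
    unfolding point_transformation_def C_class_def
    by (auto intro: Ck_on_bounded_linear bounded_linear_fst bounded_linear_snd)
  moreover have "maps_ode n V fst snd E (linear_ode n a b)"
    unfolding maps_ode_def
  proof (intro allI impI ballI)
    fix I y w x assume *: "curve_in n V I y \<and> transforms_to fst snd I y w" and x: "x \<in> I"
    then have "open I" and w: "\<And>t. t \<in> I \<Longrightarrow> w t = y t"
      by (auto simp: curve_in_def transforms_to_def)
    then have "(deriv ^^ k) w x = (deriv ^^ k) y x" for k
      using x by (intro higher_deriv_cong) auto
    then show "(E y x = 0) = (linear_ode n a b w (fst (x, y x)) = 0)"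
      using E[of I y x] * x by (simp add: linear_ode_def)
  qed
  ultimately show ?thesis
    unfolding linearizable_at_def using V by blast
qed

theorem mainTheorem2:
  fixes F :: "real \<times> real \<Rightarrow> real" and U :: "(real \<times> real) set" and p :: "real \<times> real"
    and n :: nat and r :: enat
  assumes "n \<in> {3, 4}"
    and "enat n \<le> r"
    and "open U" and "p \<in> U"
    and "C_class r F U"
  shows "(linearizable_at r n (Omega_iter F n) U p \<longleftrightarrow> (\<forall>\<^sub>F q in nhds p. pd_y F q = 0)) \<and>
         ((\<forall>\<^sub>F q in nhds p. pd_y F q = 0) \<longrightarrow> linear_at n (Omega_iter F n) U p)"
proof -
  have F: "Ck_on n F U" using assms by (auto simp: C_class_def)
  have "linear_at n (Omega_iter F n) U p" if "\<forall>\<^sub>F q in nhds p. pd_y F q = 0"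
    using assms F that by (intro linear_at_if_F_y_zero) auto
  moreover have "\<forall>\<^sub>F q in nhds p. pd_y F q = 0" if "linearizable_at r n (Omega_iter F n) U p"
  proof -
    obtain V \<rho> \<psi> a b where VU: "open V" "p \<in> V" "V \<subseteq> U" and pt: "point_transformation r V \<rho> \<psi>"
      and ab: "linear_coeffs_on n a b (\<rho> ` V)" "maps_ode n V \<rho> \<psi> (Omega_iter F n) (linear_ode n a b)"
      using \<open>linearizable_at r n (Omega_iter F n) U p\<close> unfolding linearizable_at_def by blast
    interpret linearization n V F \<rho> \<psi> a b
    proof
      show "Ck_on n F V" using F VU by (auto intro: Ck_on_subset)
      show "Ck_on n \<rho> V" "Ck_on n \<psi> V"
        using pt assms(2) by (auto simp: point_transformation_def C_class_def)
      show "jac \<rho> \<psi> q \<noteq> 0" if "q \<in> V" for q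
        using pt that by (auto simp: point_transformation_def jac_def)
    qed (use assms VU ab in auto)
    show ?thesis unfolding eventually_nhds by (intro exI[of _ V] conjI ballI VU F_y_zero)
  qed
  ultimately show ?thesis using linearizable_if_linear_at by blast
qed

end
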